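(* Let $n>1$, $m\ge1$, let $X=X_1\times\cdots\times X_m$ be the product of $m$ copies of the basic geometric crystal of type $A_{n-1}^{(1)}$ with (shifted) coordinates $x_i^{(r)}$, let $\lambda/\mu$ be a skew shape, $r,k\in\mathbb{Z}/n\mathbb{Z}$, and $c\in\mathbb{C}^*$. Let $(e_k^c)^*$ denote pullback of rational functions along $e_k^c:X\to X$. Then the loop skew Schur function $s^{(r)}_{\lambda/\mu}=s^{(r)}_{\lambda/\mu}(x_1,\dots,x_m)$ satisfies $$(e_k^c)^*\big(s^{(r)}_{\lambda/\mu}\big)=\sum_{\substack{B\subset B(\lambda/\mu)^{(r)}_{k+m},\; A\subset A(\lambda/\mu)^{(r)}_k\\ A\cap B=\emptyset}}\big((c^{-1}-1)\varepsilon_k\big)^{|B|}\,\big((c-1)\varphi_k\big)^{|A|}\,s^{(r)}_{\lambda/\mu-A-B},$$ where $\varepsilon_k,\varphi_k$ are the crystal functions of $X$.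
   Context: Upper indices (in parentheses) are taken modulo $n$. **Crystal structure on $X$.** $X_i=\{x_i=(x_i^{(i)},x_i^{(i+1)},\dots,x_i^{(i+n-1)})\}\simeq(\mathbb{C}^* )^n$ is the basic geometric crystal with shifted indexing: $\varphi_k(x_i)=x_i^{(k+i-1)}$, $\varepsilon_k(x_i)=x_i^{(k+i)}$, and $e_k^c$ multiplies $x_i^{(k+i-1)}$ by $c$ and $x_i^{(k+i)}$ by $c^{-1}$, fixing the other coordinates. The product $X\times X'$ of geometric crystals has (all as rational functions/maps) $$\varepsilon_k(x,x')=\frac{\varepsilon_k(x)\varepsilon_k(x')}{\varphi_k(x')+\varepsilon_k(x)},\quad \varphi_k(x,x')=\frac{\varphi_k(x)\varphi_k(x')}{\varepsilon_k(x)+\varphi_k(x')},\quad e_k^c(x,x')=(e_k^{c^+}x,\,e_k^{c/c^+}x'),\quad c^+=\frac{c\varphi_k(x')+\varepsilon_k(x)}{\varphi_k(x')+\varepsilon_k(x)},$$ and the structure on $X=X_1\times\cdots\times X_m$ is obtained by iterating this (the product is associative). **Loop skew Schur functions.** Diagrams are in English notation; the cell $(i,j)$ in row $i$ and column $j$ has content $c(i,j)=i-j$ (negative of the usual convention). A semistandard tableau $T$ of shape $\lambda/\mu$ fills the cells with positive integers, rows weakly increasing left to right and columns strictly increasing top to bottom. Its $r$-weight is $x^T=\prod_{s\in\lambda/\mu}x_{T(s)}^{(c(s)+r)}$, and $s^{(r)}_{\lambda/\mu}(x_1,\dots,x_m)=\sum_T x^T$, the sum over all semistandard tableaux of shape $\lambda/\mu$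 with entries in $\{1,\dots,m\}$. **Corners.** A NW corner of $\lambda/\mu$ is a cell $(i,j)\in\lambda/\mu$ with $(i-1,j),(i,j-1)\notin\lambda/\mu$; a SE corner is a cell $(i,j)\in\lambda/\mu$ with $(i+1,j),(i,j+1)\notin\lambda/\mu$. A corner $(i,j)$ has color $k$ if $i-j+r\equiv k\bmod n$. $A(\lambda/\mu)^{(r)}_k$ (resp. $B(\lambda/\mu)^{(r)}_k$) is the set of NW (resp. SE) corners of $\lambda/\mu$ of color $k$. $\lambda/\mu-A-B$ denotes the skew shape obtained by removing the cells in $A$ and $B$ (contents of the remaining cells unchanged). *)

theory Defs
  imports
    Complex_Main
    "HOL-Library.FuncSet"
    "HOL-Library.Poly_Mapping"
    "HOL-Library.Product_Lexorder"
    "HOL-Computational_Algebra.Fraction_Field"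
begin

section \<open>Rational functions in the coordinates\<close>

text \<open>
  The polynomial ring over the complex numbers has one indeterminate for every pair \<open>(i, q)\<close>,
  and \<open>ratfun\<close> is its field of fractions. The function field of \<open>X\<^sub>1 \<times> \<dots> \<times> X\<^sub>m\<close> sits in it as the
  subfield generated by the \<open>nm\<close> indeterminates with \<open>1 \<le> i \<le> m\<close> and \<open>0 \<le> q < n\<close>.
  The lexicographic order on pairs is needed only for the type class instance that makes
  the polynomial ring an integral domain.
\<close>

type_synonym cpoly = "((nat \<times> int) \<Rightarrow>\<^sub>0 nat) \<Rightarrow>\<^sub>0 complex"
type_synonym ratfun = "cpoly fract"

definition const :: "complex \<Rightarrow> ratfun"
  where "const c = Fract (Poly_Mapping.single 0 c) 1"

text \<open>
  Points of \<open>X\<^sub>1 \<times> \<dots> \<times> X\<^sub>m\<close> with coordinates in a field \<open>'k\<close> are functions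
  \<open>x :: nat \<Rightarrow> int \<Rightarrow> 'k\<close>, where \<open>x i q\<close> is the coordinate \<open>x\<^sub>i\<close> with upper index \<open>q\<close>,
  \<open>n\<close>-periodic in \<open>q\<close>, and only \<open>1 \<le> i \<le> m\<close> matters. The generic point \<open>coords n\<close> has the
  coordinate functions themselves as coordinates. A rational function on \<open>X\<close> is the value of its
  defining formula at the generic point, and a rational map from \<open>X\<close> to \<open>X\<close> is the tuple of its
  coordinate functions.
\<close>

definition coords :: "nat \<Rightarrow> nat \<Rightarrow> int \<Rightarrow> ratfun"
  where "coords n i q = Fract (Poly_Mapping.single (Poly_Mapping.single (i, q mod int n) 1) 1) 1"

definition subst :: "(nat \<Rightarrow> int \<Rightarrow> ratfun) \<Rightarrow> cpoly \<Rightarrow> ratfun"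
  where "subst F P =
    (\<Sum>t\<in>Poly_Mapping.keys P. const (Poly_Mapping.lookup P t) *
      (\<Prod>(i, q)\<in>Poly_Mapping.keys t. F i q ^ Poly_Mapping.lookup t (i, q)))"

text \<open>
  Pullback of a rational function along the rational map \<open>F\<close>. It is defined for those \<open>f\<close> that
  have a representation \<open>P / Q\<close> whose denominator does not vanish identically on the image of
  \<open>F\<close>; the value does not depend on the choice of such a representation.
\<close>

definition pullback :: "(nat \<Rightarrow> int \<Rightarrow> ratfun) \<Rightarrow> ratfun \<Rightarrow> ratfun"
  where "pullback F f =
    (THE g. \<exists>P Q. Q \<noteq> 0 \<and> f = Fract P Q \<and> subst F Q \<noteq> 0 \<and> g = subst F P / subst F Q)"


section \<open>Geometric crystals\<close>

text \<open>
  Structure maps of a geometric crystal, given on points with coordinates in an arbitrary field.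
  In \<open>act X k c\<close>, which is \<open>e\<^sub>k\<close> with parameter \<open>c\<close>, the parameter ranges over that field too, because
  the product rule uses the non-constant parameters \<open>c\<^sup>+\<close> and \<open>c / c\<^sup>+\<close>.
\<close>

record ('p, 'k) crystal =
  eps :: "int \<Rightarrow> 'p \<Rightarrow> 'k"
  phi :: "int \<Rightarrow> 'p \<Rightarrow> 'k"
  act :: "int \<Rightarrow> 'k \<Rightarrow> 'p \<Rightarrow> 'p"

definition basic_crystal :: "nat \<Rightarrow> nat \<Rightarrow> (int \<Rightarrow> 'k::field, 'k) crystal"
  where "basic_crystal n i =
    \<lparr> eps = (\<lambda>k x. x (k + int i)),
      phi = (\<lambda>k x. x (k + int i - 1)),
      act = (\<lambda>k c x q.
        if q mod int n = (k + int i - 1) mod int n then c * x q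
        else if q mod int n = (k + int i) mod int n then inverse c * x q
        else x q) \<rparr>"

definition c_plus ::
    "('p, 'k::field) crystal \<Rightarrow> ('q, 'k) crystal \<Rightarrow> int \<Rightarrow> 'k \<Rightarrow> 'p \<times> 'q \<Rightarrow> 'k"
  where "c_plus X X' k c = (\<lambda>(x, x').
    (c * phi X' k x' + eps X k x) / (phi X' k x' + eps X k x))"

definition prod_crystal ::
    "('p, 'k::field) crystal \<Rightarrow> ('q, 'k) crystal \<Rightarrow> ('p \<times> 'q, 'k) crystal"
  where "prod_crystal X X' =
    \<lparr> eps = (\<lambda>k (x, x'). eps X k x * eps X' k x' / (phi X' k x' + eps X k x)),
      phi = (\<lambda>k (x, x'). phi X k x * phi X' k x' / (eps X k x + phi X' k x')),
      act = (\<lambda>k c (x, x').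
        (act X k (c_plus X X' k c (x, x')) x,
         act X' k (c / c_plus X X' k c (x, x')) x')) \<rparr>"

text \<open>Transport of a structure on \<open>'q\<close> to \<open>'p\<close> along \<open>f\<close>, with \<open>g\<close> as the way back; \<open>g\<close> may also
  use the original point, to keep the coordinates on which the structure does not depend.\<close>

definition transport ::
    "('p \<Rightarrow> 'q) \<Rightarrow> ('p \<Rightarrow> 'q \<Rightarrow> 'p) \<Rightarrow> ('q, 'k) crystal \<Rightarrow> ('p, 'k) crystal"
  where "transport f g X =
    \<lparr> eps = (\<lambda>k x. eps X k (f x)),
      phi = (\<lambda>k x. phi X k (f x)),
      act = (\<lambda>k c x. g x (act X k c (f x))) \<rparr>"

text \<open>\<open>X\<^sub>1 \<times> \<dots> \<times> X\<^sub>m\<close> for \<open>m \<ge> 1\<close>, bracketed to the left; no equation is given for \<open>m = 0\<close>.\<close>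

fun crystal_X :: "nat \<Rightarrow> nat \<Rightarrow> (nat \<Rightarrow> int \<Rightarrow> 'k::field, 'k) crystal"
  where
    "crystal_X n (Suc 0) =
      transport (\<lambda>x. x 1) (\<lambda>x y. x(1 := y)) (basic_crystal n 1)"
  | "crystal_X n (Suc (Suc m)) =
      transport (\<lambda>x. (x, x (Suc (Suc m)))) (\<lambda>x (y, z). y(Suc (Suc m) := z))
        (prod_crystal (crystal_X n (Suc m)) (basic_crystal n (Suc (Suc m))))"


section \<open>Skew shapes and loop skew Schur functions\<close>

definition is_partition :: "nat list \<Rightarrow> bool"
  where "is_partition \<nu> \<longleftrightarrow> sorted_wrt (\<ge>) \<nu>"

text \<open>Cells are \<open>(row, column)\<close>, both starting from 1. A skew shape is represented by its set of
  cells.\<close>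

definition diagram :: "nat list \<Rightarrow> (nat \<times> nat) set"
  where "diagram \<nu> = {(i, j). 1 \<le> i \<and> i \<le> length \<nu> \<and> 1 \<le> j \<and> j \<le> \<nu> ! (i - 1)}"

definition skew :: "nat list \<Rightarrow> nat list \<Rightarrow> (nat \<times> nat) set"
  where "skew \<nu> \<mu> = diagram \<nu> - diagram \<mu>"

definition content :: "nat \<times> nat \<Rightarrow> int"
  where "content = (\<lambda>(i, j). int i - int j)"

definition ssyt :: "nat \<Rightarrow> (nat \<times> nat) set \<Rightarrow> (nat \<times> nat \<Rightarrow> nat) set"
  where "ssyt m D = {T \<in> D \<rightarrow>\<^sub>E {1..m}.
    (\<forall>i j j'. (i, j) \<in> D \<longrightarrow> (i, j') \<in> D \<longrightarrow> j < j' \<longrightarrow> T (i, j) \<le> T (i, j')) \<and>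
    (\<forall>i i' j. (i, j) \<in> D \<longrightarrow> (i', j) \<in> D \<longrightarrow> i < i' \<longrightarrow> T (i, j) < T (i', j))}"

definition loop_schur ::
    "nat \<Rightarrow> int \<Rightarrow> (nat \<times> nat) set \<Rightarrow> (nat \<Rightarrow> int \<Rightarrow> 'k::field) \<Rightarrow> 'k"
  where "loop_schur m r D x = (\<Sum>T\<in>ssyt m D. \<Prod>s\<in>D. x (T s) (content s + r))"

text \<open>Cells start from 1, so the truncated subtraction on \<open>nat\<close> yields index 0, outside every shape,
  at the boundary.\<close>

definition NW_corners :: "nat \<Rightarrow> int \<Rightarrow> int \<Rightarrow> (nat \<times> nat) set \<Rightarrow> (nat \<times> nat) set"
  where "NW_corners n r k D = {(i, j). (i, j) \<in> D \<and> (i - 1, j) \<notin> D \<and> (i, j - 1) \<notin> D \<and>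
    (int i - int j + r) mod int n = k mod int n}"

definition SE_corners :: "nat \<Rightarrow> int \<Rightarrow> int \<Rightarrow> (nat \<times> nat) set \<Rightarrow> (nat \<times> nat) set"
  where "SE_corners n r k D = {(i, j). (i, j) \<in> D \<and> (i + 1, j) \<notin> D \<and> (i, j + 1) \<notin> D \<and>
    (int i - int j + r) mod int n = k mod int n}"

end

theory Submission
  imports Defs
begin

text \<open>
  A tableau with entries up to \<open>m\<close> is a chain of shapes \<open>\<mu> = \<nu>\<^sub>0 \<subseteq> \<nu>\<^sub>1 \<subseteq> \<dots> \<subseteq> \<nu>\<^sub>m = \<lambda>\<close> whose
  successive differences are horizontal strips. So, in the incidence algebra of the poset of
  shapes, the loop skew Schur function is a product \<open>U\<^sub>1 U\<^sub>2 \<dots> U\<^sub>m\<close>, where \<open>U\<^sub>i\<close> adds a horizontal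
  strip weighted by the coordinates of \<open>x\<^sub>i\<close>. Let \<open>R\<^sub>q(a)\<close> be the element of this algebra that
  adds any set of cells of color \<open>q\<close>, each with weight \<open>a\<close>. Cells of equal color are never
  adjacent, as \<open>n > 1\<close>, so they can be added independently of each other; hence \<open>R\<^sub>q(a) R\<^sub>q(-a) =
  1\<close>. Multiplying by \<open>R\<^sub>q(a)\<close> on the left removes NW corners of color \<open>q\<close> from the skew shape,
  and on the right SE corners. So the right-hand side of the theorem is \<open>R\<^sub>k(\<alpha>) U\<^sub>1 \<dots> U\<^sub>m R\<^sub>k\<^sub>+\<^sub>m(\<gamma>)\<close>
  with \<open>\<alpha> = (c - 1) \<phi>\<^sub>k\<close> and \<open>\<gamma> = (c\<^sup>-\<^sup>1 - 1) \<epsilon>\<^sub>k\<close>.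

  For a single factor the theorem is equivalent to the exchange relation \<open>R\<^sub>q(-(c - 1) x\<^sup>q) U' = U
  R\<^sub>q\<^sub>+\<^sub>1((c\<^sup>-\<^sup>1 - 1) x\<^sup>q\<^sup>+\<^sup>1)\<close> (\<open>strip_exchange\<close>), where \<open>U'\<close> belongs to the point with \<open>x\<^sup>q\<close> multiplied
  by \<open>c\<close> and \<open>x\<^sup>q\<^sup>+\<^sup>1\<close> by \<open>c\<^sup>-\<^sup>1\<close>. Along a row of a horizontal strip these factors cancel in
  neighbouring cells, except at the two ends of the row, that is, at corners, and there the
  elements \<open>R\<close>, called patches below, account for them. For several factors, \<open>e\<^sub>k\<close> with parameter
  \<open>c\<close> acts on \<open>X \<times> X'\<close> with parameters \<open>c\<^sub>1 = c\<^sup>+\<close> and \<open>c\<^sub>2 = c / c\<^sup>+\<close>. The definition of \<open>c\<^sup>+\<close>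
  amounts to \<open>(c\<^sub>1\<^sup>-\<^sup>1 - 1) \<epsilon>\<^sub>k(x) = - (c\<^sub>2 - 1) \<phi>\<^sub>k(x')\<close>, so that the patch left behind by \<open>X\<close> is
  exactly the one that the exchange relation for \<open>X'\<close> consumes, while \<open>(c\<^sub>1 - 1) \<phi>\<^sub>k(x)\<close> and
  \<open>(c\<^sub>2\<^sup>-\<^sup>1 - 1) \<epsilon>\<^sub>k(x')\<close> are the values \<open>\<alpha>\<close> and \<open>\<gamma>\<close> of the product. Induction on \<open>m\<close> gives
  \<open>loop_schur_act\<close>, over any field and at any point where no denominator vanishes.

  It remains to see that the generic point is such a point (\<open>act_defined_coords\<close>): when all
  \<open>\<phi>\<^sub>k(x\<^sub>i)\<close> are specialized to 0 and all \<open>\<epsilon>\<^sub>k(x\<^sub>i)\<close> to 1, every denominator takes the value 1.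
\<close>

section \<open>Convolution of functions on skew shapes\<close>

definition weakly_above :: "nat \<times> nat \<Rightarrow> nat \<times> nat \<Rightarrow> bool"
  where "weakly_above s t \<longleftrightarrow> fst s \<le> fst t \<and> snd s \<le> snd t"

text \<open>
  The finite convex sets of cells, which are the differences of two finite order ideals. Cells
  with a coordinate 0 are excluded because the truncated subtraction in \<open>NW_corners\<close> would make
  such a cell its own neighbour.
\<close>

definition skew_shape :: "(nat \<times> nat) set \<Rightarrow> bool"
  where "skew_shape D \<longleftrightarrow> finite D \<and> (\<forall>s\<in>D. 0 < fst s \<and> 0 < snd s) \<and>
    (\<forall>s\<in>D. \<forall>t\<in>D. \<forall>u. weakly_above s u \<and> weakly_above u t \<longrightarrow> u \<in> D)"

definition ideals :: "(nat \<times> nat) set \<Rightarrow> (nat \<times> nat) set set"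
  where "ideals D = {E. E \<subseteq> D \<and> (\<forall>s\<in>E. \<forall>t\<in>D. weakly_above t s \<longrightarrow> t \<in> E)}"

text \<open>
  The product of the incidence algebra: if \<open>D\<close> is \<open>\<lambda> - \<mu>\<close> for two shapes, then the order ideals
  of \<open>D\<close> are the sets \<open>\<nu> - \<mu>\<close> for the shapes \<open>\<nu>\<close> in between. Working with the set \<open>D\<close> makes \<open>\<lambda>\<close>
  and \<open>\<mu>\<close> disappear.
\<close>

definition conv ::
    "((nat \<times> nat) set \<Rightarrow> 'k::field) \<Rightarrow> ((nat \<times> nat) set \<Rightarrow> 'k) \<Rightarrow> (nat \<times> nat) set \<Rightarrow> 'k"
  where "conv f g D = (\<Sum>E\<in>ideals D. f E * g (D - E))"

lemma skew_shapeD: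
  assumes "skew_shape D"
  shows "finite D" "(i, j) \<in> D \<Longrightarrow> 0 < i" "(i, j) \<in> D \<Longrightarrow> 0 < j"
    and "(i, j) \<in> D \<Longrightarrow> (i', j') \<in> D \<Longrightarrow> i \<le> a \<Longrightarrow> a \<le> i' \<Longrightarrow> j \<le> b \<Longrightarrow> b \<le> j' \<Longrightarrow> (a, b) \<in> D"
  using assms unfolding skew_shape_def weakly_above_def by fastforce+

lemma idealsD:
  assumes "E \<in> ideals D"
  shows "E \<subseteq> D" "(i, j) \<in> E \<Longrightarrow> (a, b) \<in> D \<Longrightarrow> a \<le> i \<Longrightarrow> b \<le> j \<Longrightarrow> (a, b) \<in> E"
  using assms unfolding ideals_def weakly_above_def by fastforce+

lemma finite_ideals: "finite D \<Longrightarrow> finite (ideals D)"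
  by (rule finite_subset[of _ "Pow D"]) (auto simp: ideals_def)

lemma skew_shape_ideal:
  assumes "skew_shape D" "E \<in> ideals D"
  shows "skew_shape E" "skew_shape (D - E)"
proof -
  have E: "E \<subseteq> D" using assms(2) by (rule idealsD)
  have fin: "finite D" using assms(1) by (simp add: skew_shape_def)
  show "skew_shape E"
    using assms E finite_subset[OF E fin] unfolding skew_shape_def ideals_def by blast
  show "skew_shape (D - E)"
    using assms E fin unfolding skew_shape_def ideals_def by blast
qed

lemma conv_cong:
  assumes "\<And>E. E \<in> ideals D \<Longrightarrow> f E = f' E" "\<And>E. E \<in> ideals D \<Longrightarrow> g (D - E) = g' (D - E)"
  shows "conv f g D = conv f' g' D"
  unfolding conv_def using assms by (intro sum.cong) auto

lemma conv_cong_skew: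
  assumes "skew_shape D" "\<And>E. skew_shape E \<Longrightarrow> f E = f' E" "\<And>E. skew_shape E \<Longrightarrow> g E = g' E"
  shows "conv f g D = conv f' g' D"
  using assms skew_shape_ideal by (intro conv_cong) auto

text \<open>
  Both sides sum over the ways to cut \<open>D\<close> into three consecutive layers.
\<close>

lemma conv_assoc:
  assumes "finite D"
  shows "conv (conv f g) h D = conv f (conv g h) D"
proof -
  have "conv (conv f g) h D = (\<Sum>E\<in>ideals D. \<Sum>F\<in>ideals E. f F * g (E - F) * h (D - E))"
    by (simp add: conv_def sum_distrib_right)
  also have "\<dots> = (\<Sum>(E, F)\<in>Sigma (ideals D) ideals. f F * g (E - F) * h (D - E))"
    using assms finite_subset[OF idealsD(1)] by (intro sum.Sigma) (auto intro!: finite_ideals)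
  also have "\<dots> = (\<Sum>(F, G)\<in>(SIGMA F:ideals D. ideals (D - F)). f F * g G * h (D - F - G))"
  proof (rule sum.reindex_bij_witness[where i = "\<lambda>(F, G). (F \<union> G, F)" and j = "\<lambda>(E, F). (F, E - F)"])
    fix p assume "p \<in> Sigma (ideals D) ideals"
    then obtain E F where p: "p = (E, F)" and E: "E \<in> ideals D" and F: "F \<in> ideals E" by auto
    have FE: "F \<subseteq> E" "E \<subseteq> D" using E F by (auto dest: idealsD)
    then show "(case (case p of (E, F) \<Rightarrow> (F, E - F)) of (F, G) \<Rightarrow> (F \<union> G, F)) = p"
      using p by auto
    have "F \<in> ideals D" using E F unfolding ideals_def by blast
    moreover have "E - F \<in> ideals (D - F)" using E F unfolding ideals_def by blast
    ultimately show "(case p of (E, F) \<Rightarrow> (F, E - F)) \<in> (SIGMA F:ideals D. ideals (D - F))"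
      using p by auto
    have "D - F - (E - F) = D - E" using FE by auto
    then show "(case case p of (E, F) \<Rightarrow> (F, E - F) of (F, G) \<Rightarrow> f F * g G * h (D - F - G)) =
         (case p of (E, F) \<Rightarrow> f F * g (E - F) * h (D - E))"
      using p by simp
  next
    fix p assume "p \<in> (SIGMA F:ideals D. ideals (D - F))"
    then obtain F G where p: "p = (F, G)" and F: "F \<in> ideals D" and G: "G \<in> ideals (D - F)" by auto
    have FG: "F \<subseteq> D" "G \<subseteq> D - F" using F G by (auto dest: idealsD)
    then show "(case (case p of (F, G) \<Rightarrow> (F \<union> G, F)) of (E, F) \<Rightarrow> (F, E - F)) = p"
      using p by auto
    have "F \<union> G \<in> ideals D" using F G unfolding ideals_def by blast
    moreover have "F \<in> ideals (F \<union> G)" using F G unfolding ideals_def by blast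
    ultimately show "(case p of (F, G) \<Rightarrow> (F \<union> G, F)) \<in> Sigma (ideals D) ideals"
      using p by auto
  qed
  also have "\<dots> = (\<Sum>F\<in>ideals D. \<Sum>G\<in>ideals (D - F). f F * g G * h (D - F - G))"
    using assms by (intro sum.Sigma[symmetric]) (auto intro!: finite_ideals)
  also have "\<dots> = conv f (conv g h) D"
    by (simp add: conv_def sum_distrib_left mult.assoc)
  finally show ?thesis .
qed

section \<open>Patches of cells of one color\<close>

definition colored :: "nat \<Rightarrow> int \<Rightarrow> int \<Rightarrow> nat \<times> nat \<Rightarrow> bool"
  where "colored n r q s \<longleftrightarrow> (content s + r) mod int n = q mod int n"

text \<open>
  The element \<open>R\<^sub>q(a)\<close> of the introduction.
\<close>

definition patch :: "nat \<Rightarrow> int \<Rightarrow> int \<Rightarrow> 'k::field \<Rightarrow> (nat \<times> nat) set \<Rightarrow> 'k"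
  where "patch n r q a D = (if \<forall>s\<in>D. colored n r q s then a ^ card D else 0)"

lemma colored_neighbours:
  assumes "n > 1"
  shows "colored n r q (i, j) \<Longrightarrow> \<not> colored n r q (Suc i, j)"
    and "colored n r q (i, j) \<Longrightarrow> \<not> colored n r q (i, Suc j)"
proof -
  have *: "(a + 1) mod int n \<noteq> a mod int n" for a
  proof
    assume "(a + 1) mod int n = a mod int n"
    then have "int n dvd (a + 1) - a" by (simp only: mod_eq_dvd_iff)
    then show False using assms by simp
  qed
  show "colored n r q (i, j) \<Longrightarrow> \<not> colored n r q (Suc i, j)"
    using *[of "int i - int j + r"] by (auto simp: colored_def content_def algebra_simps)
  show "colored n r q (i, j) \<Longrightarrow> \<not> colored n r q (i, Suc j)"
    using *[of "int i - int (Suc j) + r"] by (auto simp: colored_def content_def algebra_simps)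
qed

lemma colored_shift:
  shows "colored n r (q + 1) (Suc i, j) \<longleftrightarrow> colored n r q (i, j)"
    and "colored n r (q + 1) (i, j) \<longleftrightarrow> colored n r q (i, Suc j)"
proof -
  have *: "(a + 1) mod int n = (b + 1) mod int n \<longleftrightarrow> a mod int n = b mod int n" for a b
    by (simp add: mod_eq_dvd_iff)
  show "colored n r (q + 1) (Suc i, j) \<longleftrightarrow> colored n r q (i, j)"
    using *[of "int i - int j + r" q] by (auto simp: colored_def content_def algebra_simps)
  show "colored n r (q + 1) (i, j) \<longleftrightarrow> colored n r q (i, Suc j)"
    using *[of "int i - int (Suc j) + r" q] by (auto simp: colored_def content_def algebra_simps)
qed

lemma NW_corners_iff:
  assumes "skew_shape D"
  shows "(i, j) \<in> NW_corners n r q D \<longleftrightarrow>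
    (i, j) \<in> D \<and> colored n r q (i, j) \<and> (\<forall>a b. (a, b) \<in> D \<longrightarrow> a \<le> i \<longrightarrow> b \<le> j \<longrightarrow> (a, b) = (i, j))"
  (is "?L \<longleftrightarrow> ?R")
proof
  assume L: ?L
  then have ij: "(i, j) \<in> D" "(i - 1, j) \<notin> D" "(i, j - 1) \<notin> D" "colored n r q (i, j)"
    by (auto simp: NW_corners_def colored_def content_def)
  moreover have "(a, b) = (i, j)" if "(a, b) \<in> D" "a \<le> i" "b \<le> j" for a b
  proof (rule ccontr)
    assume "(a, b) \<noteq> (i, j)"
    then have "a \<le> i - 1 \<or> b \<le> j - 1" using that by auto
    then show False
      using ij that skew_shapeD(4)[OF assms that(1) ij(1), of "i - 1" j]
        skew_shapeD(4)[OF assms that(1) ij(1), of i "j - 1"] by auto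
  qed
  ultimately show ?R by blast
next
  assume R: ?R
  then have "0 < i" "0 < j" using skew_shapeD(2,3)[OF assms] by blast+
  then have "(i - 1, j) \<notin> D" "(i, j - 1) \<notin> D" using R by fastforce+
  then show ?L using R by (auto simp: NW_corners_def colored_def content_def)
qed

lemma SE_corners_iff:
  assumes "skew_shape D"
  shows "(i, j) \<in> SE_corners n r q D \<longleftrightarrow>
    (i, j) \<in> D \<and> colored n r q (i, j) \<and> (\<forall>a b. (a, b) \<in> D \<longrightarrow> i \<le> a \<longrightarrow> j \<le> b \<longrightarrow> (a, b) = (i, j))"
  (is "?L \<longleftrightarrow> ?R")
proof
  assume L: ?L
  then have ij: "(i, j) \<in> D" "(i + 1, j) \<notin> D" "(i, j + 1) \<notin> D" "colored n r q (i, j)"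
    by (auto simp: SE_corners_def colored_def content_def)
  moreover have "(a, b) = (i, j)" if "(a, b) \<in> D" "i \<le> a" "j \<le> b" for a b
  proof (rule ccontr)
    assume "(a, b) \<noteq> (i, j)"
    then have "i + 1 \<le> a \<or> j + 1 \<le> b" using that by auto
    then show False
      using ij that skew_shapeD(4)[OF assms ij(1) that(1), of "i + 1" j]
        skew_shapeD(4)[OF assms ij(1) that(1), of i "j + 1"] by auto
  qed
  ultimately show ?R by blast
next
  assume R: ?R
  then have "(i + 1, j) \<notin> D" "(i, j + 1) \<notin> D" by fastforce+
  then show ?L using R by (auto simp: SE_corners_def colored_def content_def)
qed

text \<open>
  An ideal that contains a cell contains its neighbours above and to the left, if they are in
  \<open>D\<close>; but these have another color than the cell. So all cells of a one-colored ideal are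
  corners. Conversely a NW corner has no other cell of \<open>D\<close> weakly above it, because \<open>D\<close> is
  convex.
\<close>

lemma colored_ideal_iff:
  assumes "n > 1" "skew_shape D"
  shows "E \<in> ideals D \<and> (\<forall>s\<in>E. colored n r q s) \<longleftrightarrow> E \<subseteq> NW_corners n r q D"
  (is "?L \<longleftrightarrow> ?R")
proof
  assume L: ?L
  show ?R
  proof
    fix s assume s: "s \<in> E"
    obtain i j where ij: "s = (i, j)" by (cases s)
    have sD: "(i, j) \<in> D" using L s ij idealsD by blast
    then have pos: "0 < i" "0 < j" using skew_shapeD(2,3)[OF assms(2) sD] by auto
    have c: "colored n r q (i, j)" using L s ij by auto
    have "(i - 1, j) \<notin> D"
    proof
      assume "(i - 1, j) \<in> D"
      then have "(i - 1, j) \<in> E" using L s ij idealsD(2)[of E D i j "i - 1" j] by auto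
      then show False using L c colored_neighbours(1)[OF assms(1), of r q "i - 1" j] pos by auto
    qed
    moreover have "(i, j - 1) \<notin> D"
    proof
      assume "(i, j - 1) \<in> D"
      then have "(i, j - 1) \<in> E" using L s ij idealsD(2)[of E D i j i "j - 1"] by auto
      then show False using L c colored_neighbours(2)[OF assms(1), of r q i "j - 1"] pos by auto
    qed
    ultimately show "s \<in> NW_corners n r q D"
      using sD c ij by (auto simp: NW_corners_def colored_def content_def)
  qed
next
  assume R: ?R
  have "E \<subseteq> D" using R by (auto simp: NW_corners_def)
  moreover have "t \<in> E" if "s \<in> E" "t \<in> D" "weakly_above t s" for s t
  proof -
    have "s \<in> NW_corners n r q D" using that R by auto
    then have "t = s" using NW_corners_iff[OF assms(2), of "fst s" "snd s" n r q] that
      by (cases s; cases t) (auto simp: weakly_above_def)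
    then show ?thesis using that by simp
  qed
  ultimately show ?L using R by (auto simp: ideals_def NW_corners_def colored_def content_def)
qed

text \<open>
  The mirror image of the preceding lemma, for complements of ideals.
\<close>

lemma colored_filter_iff:
  assumes "n > 1" "skew_shape D" "B \<subseteq> D"
  shows "D - B \<in> ideals D \<and> (\<forall>s\<in>B. colored n r q s) \<longleftrightarrow> B \<subseteq> SE_corners n r q D"
  (is "?L \<longleftrightarrow> ?R")
proof
  assume L: ?L
  have up: "(a, b) \<in> B" if "(i, j) \<in> B" "(a, b) \<in> D" "i \<le> a" "j \<le> b" for i j a b
    using L idealsD(2)[of "D - B" D a b i j] that assms(3) by blast
  show ?R
  proof
    fix s assume s: "s \<in> B"
    obtain i j where ij: "s = (i, j)" by (cases s)
    have sD: "(i, j) \<in> D" using s ij assms by blast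
    have c: "colored n r q (i, j)" using L s ij by auto
    have "(i + 1, j) \<notin> D"
      using up[of i j "i + 1" j] L s ij c colored_neighbours(1)[OF assms(1), of r q i j] by auto
    moreover have "(i, j + 1) \<notin> D"
      using up[of i j i "j + 1"] L s ij c colored_neighbours(2)[OF assms(1), of r q i j] by auto
    ultimately show "s \<in> SE_corners n r q D"
      using sD c ij by (auto simp: SE_corners_def colored_def content_def)
  qed
next
  assume R: ?R
  have "t \<in> D - B" if "s \<in> D - B" "t \<in> D" "weakly_above t s" for s t
  proof -
    have "t \<notin> B"
    proof
      assume "t \<in> B"
      then have "t \<in> SE_corners n r q D" using R by auto
      then have "s = t" using SE_corners_iff[OF assms(2), of "fst t" "snd t" n r q] that
        by (cases s; cases t) (auto simp: weakly_above_def)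
      then show False using that \<open>t \<in> B\<close> by simp
    qed
    then show ?thesis using that by simp
  qed
  then show ?L using R by (auto simp: ideals_def SE_corners_def colored_def content_def)
qed

lemma NW_corners_subset: "NW_corners n r q D \<subseteq> D"
  by (auto simp: NW_corners_def)

lemma SE_corners_subset: "SE_corners n r q D \<subseteq> D"
  by (auto simp: SE_corners_def)

lemma conv_patch_left:
  assumes "n > 1" "skew_shape D"
  shows "conv (patch n r q a) f D = (\<Sum>A\<in>Pow (NW_corners n r q D). a ^ card A * f (D - A))"
proof -
  have "conv (patch n r q a) f D =
      (\<Sum>A\<in>{A\<in>ideals D. \<forall>s\<in>A. colored n r q s}. a ^ card A * f (D - A))"
    unfolding conv_def patch_def using finite_ideals[OF skew_shapeD(1)[OF assms(2)]]
    by (intro sum.mono_neutral_cong_right) auto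
  moreover have "{A\<in>ideals D. \<forall>s\<in>A. colored n r q s} = Pow (NW_corners n r q D)"
    using colored_ideal_iff[OF assms] by auto
  ultimately show ?thesis by simp
qed

lemma conv_patch_right:
  assumes "n > 1" "skew_shape D"
  shows "conv f (patch n r q a) D = (\<Sum>B\<in>Pow (SE_corners n r q D). f (D - B) * a ^ card B)"
proof -
  have "conv f (patch n r q a) D =
      (\<Sum>E\<in>{E\<in>ideals D. \<forall>s\<in>D - E. colored n r q s}. f E * a ^ card (D - E))"
    unfolding conv_def patch_def using finite_ideals[OF skew_shapeD(1)[OF assms(2)]]
    by (intro sum.mono_neutral_cong_right) auto
  also have "\<dots> = (\<Sum>B\<in>Pow (SE_corners n r q D). f (D - B) * a ^ card B)"
  proof (rule sum.reindex_bij_witness[where i = "\<lambda>B. D - B" and j = "\<lambda>E. D - E"])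
    fix E assume E: "E \<in> {E\<in>ideals D. \<forall>s\<in>D - E. colored n r q s}"
    then have ED: "D - (D - E) = E" by (auto dest: idealsD)
    then show "D - (D - E) = E" .
    show "D - E \<in> Pow (SE_corners n r q D)"
      using colored_filter_iff[OF assms, of "D - E" r q] E ED by auto
    show "f (D - (D - E)) * a ^ card (D - E) = f E * a ^ card (D - E)" using ED by simp
  next
    fix B assume B: "B \<in> Pow (SE_corners n r q D)"
    then have BD: "B \<subseteq> D" using SE_corners_subset by blast
    then show BB: "D - (D - B) = B" by auto
    show "D - B \<in> {E\<in>ideals D. \<forall>s\<in>D - E. colored n r q s}"
      using colored_filter_iff[OF assms BD, of r q] B BB by auto
  qed
  finally show ?thesis .
qed

definition unit_shape :: "(nat \<times> nat) set \<Rightarrow> 'k::field"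
  where "unit_shape D = (if D = {} then 1 else 0)"

lemma conv_unit_left: "finite D \<Longrightarrow> conv unit_shape f D = f D"
proof -
  assume fin: "finite D"
  have "conv unit_shape f D = (\<Sum>E\<in>{{}}. unit_shape E * f (D - E))"
    unfolding conv_def using finite_ideals[OF fin]
    by (intro sum.mono_neutral_right) (auto simp: unit_shape_def ideals_def)
  then show ?thesis by (simp add: unit_shape_def)
qed

text \<open>
  A convex set of cells of one color is an antichain, so every subset is an ideal and the
  convolution is the binomial expansion of a product of factors \<open>a + (- a)\<close>, one for each cell.
\<close>

lemma conv_patch_inverse:
  assumes "n > 1" "skew_shape D"
  shows "conv (patch n r q a) (patch n r q (- a)) D = unit_shape D"
proof (cases "\<forall>s\<in>D. colored n r q s")
  case True
  have fin: "finite D" using assms(2) by (rule skew_shapeD)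
  have "D \<in> ideals D" by (auto simp: ideals_def)
  then have NW: "NW_corners n r q D = D"
    using colored_ideal_iff[OF assms, of D r q] True NW_corners_subset[of n r q D] by auto
  have "conv (patch n r q a) (patch n r q (- a)) D
      = (\<Sum>A\<in>Pow D. (\<Prod>s\<in>A. a) * (\<Prod>s\<in>D - A. - a))"
    using True unfolding conv_patch_left[OF assms] NW by (intro sum.cong) (auto simp: patch_def)
  also have "\<dots> = (\<Prod>s\<in>D. a + - a)" by (rule prod_add[OF fin, symmetric])
  also have "\<dots> = unit_shape D" using fin by (auto simp: unit_shape_def)
  finally show ?thesis .
next
  case False
  then obtain s where s: "s \<in> D" "\<not> colored n r q s" by blast
  then have "s \<notin> NW_corners n r q D" by (auto simp: NW_corners_def colored_def content_def)
  then have "patch n r q (- a) (D - A) = 0" if "A \<subseteq> NW_corners n r q D" for A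
    using s that by (auto simp: patch_def)
  then have "conv (patch n r q a) (patch n r q (- a)) D = 0"
    unfolding conv_patch_left[OF assms] by (intro sum.neutral) auto
  with False show ?thesis using False by (auto simp: unit_shape_def)
qed

section \<open>Splitting off the largest entry of a tableau\<close>

text \<open>
  The loop skew Schur function in a single variable, the element \<open>U\<close> of the introduction. A
  convex set with two cells in the same column also has two adjacent ones, so only those need to
  be excluded.
\<close>

definition strip :: "int \<Rightarrow> (int \<Rightarrow> 'k::field) \<Rightarrow> (nat \<times> nat) set \<Rightarrow> 'k"
  where "strip r w D =
    (if \<exists>i j. (i, j) \<in> D \<and> (Suc i, j) \<in> D then 0 else (\<Prod>s\<in>D. w (content s + r)))"

text \<open>
  In a semistandard tableau the entries that are at most \<open>m\<close> occupy an ideal, and the entries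
  \<open>Suc m\<close> a set without two cells in a column.
\<close>

lemma loop_schur_Suc:
  assumes "skew_shape D"
  shows "loop_schur (Suc m) r D x =
    conv (\<lambda>E. loop_schur m r E x) (strip r (x (Suc m))) D"
proof -
  have fin: "finite D" using assms by (rule skew_shapeD)
  let ?w = "\<lambda>T s. x (T s) (content s + r)"
  \<comment> \<open>The ideals that leave a horizontal strip; all others contribute 0 to the convolution.\<close>
  define I where "I = {E \<in> ideals D. \<forall>i j. (i, j) \<in> D - E \<longrightarrow> (Suc i, j) \<notin> D - E}"
  define ext where "ext E T = (\<lambda>s. if s \<in> E then T s else if s \<in> D then Suc m else undefined)"
    for E and T :: "nat \<times> nat \<Rightarrow> nat"
  have finI: "finite I" unfolding I_def using finite_ideals[OF fin] by simp
  have fin_ssyt: "finite (ssyt m E)" if "finite E" for E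
    by (rule finite_subset[of _ "E \<rightarrow>\<^sub>E {1..m}"]) (auto simp: ssyt_def intro!: finite_PiE that)
  have finE: "finite E" if "E \<in> I" for E
    using that idealsD(1)[of E D] finite_subset[OF _ fin] by (auto simp: I_def)
  have "conv (\<lambda>E. loop_schur m r E x) (strip r (x (Suc m))) D
     = (\<Sum>E\<in>I. loop_schur m r E x * (\<Prod>s\<in>D - E. x (Suc m) (content s + r)))"
    unfolding conv_def I_def strip_def using finite_ideals[OF fin]
    by (intro sum.mono_neutral_cong_right) (auto simp: Bex_def)
  also have "\<dots> = (\<Sum>E\<in>I. \<Sum>T\<in>ssyt m E. (\<Prod>s\<in>E. ?w T s) * (\<Prod>s\<in>D - E. x (Suc m) (content s + r)))"
    by (simp add: loop_schur_def sum_distrib_right)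
  also have "\<dots> = (\<Sum>(E, T)\<in>Sigma I (ssyt m).
      (\<Prod>s\<in>E. ?w T s) * (\<Prod>s\<in>D - E. x (Suc m) (content s + r)))"
    using finI finE fin_ssyt by (intro sum.Sigma) auto
  also have "\<dots> = (\<Sum>T\<in>ssyt (Suc m) D. \<Prod>s\<in>D. ?w T s)"
  proof (rule sum.reindex_bij_witness[where j = "\<lambda>(E, T). ext E T"
        and i = "\<lambda>T. ({s\<in>D. T s \<le> m}, restrict T {s\<in>D. T s \<le> m})"])
    fix p assume "p \<in> Sigma I (ssyt m)"
    then obtain E T where p: "p = (E, T)" and E: "E \<in> I" and T: "T \<in> ssyt m E" by auto
    have ED: "E \<subseteq> D" using E idealsD(1) by (auto simp: I_def)
    have EI: "E \<in> ideals D" using E by (simp add: I_def)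
    have T_range: "T s \<in> {1..m}" if "s \<in> E" for s using T that by (auto simp: ssyt_def)
    have T_undef: "T s = undefined" if "s \<notin> E" for s
      using T that by (cases s) (auto simp: ssyt_def PiE_def extensional_def)
    have low: "{s\<in>D. ext E T s \<le> m} = E"
      using T_range ED by (auto simp: ext_def split: if_splits)
    have "restrict (ext E T) E = T" using T_undef by (auto simp: ext_def restrict_def)
    then show "(\<lambda>T. ({s\<in>D. T s \<le> m}, restrict T {s\<in>D. T s \<le> m})) (case p of (E, T) \<Rightarrow> ext E T) = p"
      using p low by simp
    show "(case p of (E, T) \<Rightarrow> ext E T) \<in> ssyt (Suc m) D"
    proof -
      have "ext E T \<in> D \<rightarrow>\<^sub>E {1..Suc m}"
        using T_range ED by (force simp: ext_def)
      moreover have "ext E T (i, j) \<le> ext E T (i, j')"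
        if "(i, j) \<in> D" "(i, j') \<in> D" "j < j'" for i j j'
      proof (cases "(i, j') \<in> E")
        case True
        then have "(i, j) \<in> E" using idealsD(2)[OF EI] that by auto
        then show ?thesis using True that T by (auto simp: ext_def ssyt_def)
      next
        case False
        then show ?thesis using that T_range[of "(i, j)"] by (auto simp: ext_def)
      qed
      moreover have "ext E T (i, j) < ext E T (i', j)"
        if "(i, j) \<in> D" "(i', j) \<in> D" "i < i'" for i i' j
      proof (cases "(i', j) \<in> E")
        case True
        then have "(i, j) \<in> E" using idealsD(2)[OF EI] that by auto
        then show ?thesis using True that T by (auto simp: ext_def ssyt_def)
      next
        case False
        have "(i, j) \<in> E"
        proof (rule ccontr)
          assume nE: "(i, j) \<notin> E"
          have SD: "(Suc i, j) \<in> D"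
            using skew_shapeD(4)[OF assms that(1,2), of "Suc i" j] that by auto
          then have "(Suc i, j) \<notin> E" using nE idealsD(2)[OF EI, of "Suc i" j i j] that by auto
          then show False using E SD nE that by (auto simp: I_def)
        qed
        then show ?thesis using False that T_range[of "(i, j)"] by (auto simp: ext_def)
      qed
      ultimately show ?thesis using p by (auto simp: ssyt_def)
    qed
    have "(\<Prod>s\<in>D. ?w (ext E T) s) = (\<Prod>s\<in>E. ?w (ext E T) s) * (\<Prod>s\<in>D - E. ?w (ext E T) s)"
      using prod.subset_diff[OF ED fin, of "?w (ext E T)"] by (simp add: mult.commute)
    also have "\<dots> = (\<Prod>s\<in>E. ?w T s) * (\<Prod>s\<in>D - E. x (Suc m) (content s + r))"
      by (auto intro!: arg_cong2[of _ _ _ _ "(*)"] prod.cong simp: ext_def)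
    finally show "(\<Prod>s\<in>D. ?w (case p of (E, T) \<Rightarrow> ext E T) s) =
        (case p of (E, T) \<Rightarrow> (\<Prod>s\<in>E. ?w T s) * (\<Prod>s\<in>D - E. x (Suc m) (content s + r)))"
      using p by simp
  next
    fix T assume T: "T \<in> ssyt (Suc m) D"
    let ?E = "{s\<in>D. T s \<le> m}"
    have row: "T (i, j) \<le> T (i, j')" if "(i, j) \<in> D" "(i, j') \<in> D" "j \<le> j'" for i j j'
      using T that by (cases "j = j'") (auto simp: ssyt_def)
    have col: "T (i, j) < T (i', j)" if "(i, j) \<in> D" "(i', j) \<in> D" "i < i'" for i i' j
      using T that by (auto simp: ssyt_def)
    have range: "T s \<in> {1..Suc m}" if "s \<in> D" for s using T that by (auto simp: ssyt_def)
    have top: "T s = Suc m" if "s \<in> D" "\<not> T s \<le> m" for s using range[OF that(1)] that(2) by auto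
    have "t \<in> ?E" if "s \<in> ?E" "t \<in> D" "weakly_above t s" for s t
    proof -
      obtain i j a b where st: "s = (i, j)" "t = (a, b)" by (cases s; cases t)
      have le: "a \<le> i" "b \<le> j" using that st by (auto simp: weakly_above_def)
      have aj: "(a, j) \<in> D" using skew_shapeD(4)[OF assms, of a b i j a j] that st le by auto
      have "T (a, b) \<le> T (a, j)" using row aj that st le by auto
      also have "\<dots> \<le> T (i, j)"
        using col[of a j i] aj that st le by (cases "a = i") auto
      finally show ?thesis using that st by auto
    qed
    then have "?E \<in> ideals D" by (auto simp: ideals_def)
    moreover have "(Suc i, j) \<notin> D - ?E" if "(i, j) \<in> D - ?E" for i j
      using col[of i j "Suc i"] top[of "(i, j)"] top[of "(Suc i, j)"] that by auto
    ultimately have "?E \<in> I" by (auto simp: I_def)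
    moreover have "restrict T ?E \<in> ssyt m ?E"
      using range row col by (auto simp: ssyt_def)
    ultimately show "(?E, restrict T ?E) \<in> Sigma I (ssyt m)" by simp
    have undef: "T s = undefined" if "s \<notin> D" for s
      using T that by (cases s) (auto simp: ssyt_def PiE_def extensional_def)
    show "(case (?E, restrict T ?E) of (E, T) \<Rightarrow> ext E T) = T"
      using top undef by (auto simp: ext_def fun_eq_iff)
  qed
  finally show ?thesis by (simp add: loop_schur_def)
qed

lemma loop_schur_0:
  assumes "finite D"
  shows "loop_schur 0 r D x = unit_shape D"
proof (cases "D = {}")
  case True
  then have "ssyt 0 D = {\<lambda>_. undefined}" by (auto simp: ssyt_def)
  then show ?thesis using True by (simp add: loop_schur_def unit_shape_def)
next
  case False
  then have "ssyt 0 D = {}" by (auto simp: ssyt_def)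
  then show ?thesis using False by (simp add: loop_schur_def unit_shape_def)
qed

section \<open>The exchange relation for one variable\<close>

text \<open>
  If the upper cell of every vertical pair is a NW corner of color \<open>q\<close>, then no column has three
  cells, since the middle one would be the upper cell of a pair without being a corner. A
  neighbour to the right of the lower cell of a pair would come, by convexity, with one to the
  right of the upper cell, and these two would form a pair whose upper cell has the wrong color.
  So the lower cells are SE corners; their color is one more than that of the upper cells. The
  converse is symmetric.
\<close>

lemma column_pairs_at_corners:
  assumes "n > 1" "skew_shape D"
  shows "(\<forall>i j. (i, j) \<in> D \<longrightarrow> (Suc i, j) \<in> D \<longrightarrow> (i, j) \<in> NW_corners n r q D) \<longleftrightarrow>
    (\<forall>i j. (i, j) \<in> D \<longrightarrow> (Suc i, j) \<in> D \<longrightarrow> (Suc i, j) \<in> SE_corners n r (q + 1) D)"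
  (is "?L \<longleftrightarrow> ?R")
proof
  assume L: ?L
  show ?R
  proof (intro allI impI)
    fix i j assume ij: "(i, j) \<in> D" "(Suc i, j) \<in> D"
    then have nw: "(i, j) \<in> NW_corners n r q D" using L by blast
    then have c: "colored n r q (i, j)" by (simp add: NW_corners_iff[OF assms(2)])
    have "(Suc (Suc i), j) \<notin> D"
    proof
      assume "(Suc (Suc i), j) \<in> D"
      then have "(Suc i, j) \<in> NW_corners n r q D" using L ij by blast
      then show False using c colored_neighbours(1)[OF assms(1)] by (simp add: NW_corners_iff[OF assms(2)])
    qed
    moreover have "(Suc i, Suc j) \<notin> D"
    proof
      assume ne: "(Suc i, Suc j) \<in> D"
      then have "(i, Suc j) \<in> D" using skew_shapeD(4)[OF assms(2) ij(1) ne, of i "Suc j"] by simp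
      then have "(i, Suc j) \<in> NW_corners n r q D" using L ne by blast
      then show False using c colored_neighbours(2)[OF assms(1)] by (simp add: NW_corners_iff[OF assms(2)])
    qed
    moreover have "colored n r (q + 1) (Suc i, j)" using c colored_shift(1) by blast
    ultimately show "(Suc i, j) \<in> SE_corners n r (q + 1) D"
      using ij by (auto simp: SE_corners_def colored_def content_def)
  qed
next
  assume R: ?R
  show ?L
  proof (intro allI impI)
    fix i j assume ij: "(i, j) \<in> D" "(Suc i, j) \<in> D"
    then have pos: "0 < i" "0 < j" using skew_shapeD(2,3)[OF assms(2)] by blast+
    have se: "(Suc i, j) \<in> SE_corners n r (q + 1) D" using R ij by blast
    then have c1: "colored n r (q + 1) (Suc i, j)" by (simp add: SE_corners_iff[OF assms(2)])
    have "(i - 1, j) \<notin> D"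
    proof
      assume "(i - 1, j) \<in> D"
      then have "(i, j) \<in> SE_corners n r (q + 1) D" using R[rule_format, of "i - 1" j] ij pos by simp
      then show False using ij by (simp add: SE_corners_def)
    qed
    moreover have "(i, j - 1) \<notin> D"
    proof
      assume ne: "(i, j - 1) \<in> D"
      then have d: "(Suc i, j - 1) \<in> D"
        using skew_shapeD(4)[OF assms(2) ne ij(2), of "Suc i" "j - 1"] by simp
      then have "(Suc i, j - 1) \<in> SE_corners n r (q + 1) D" using R ne by blast
      then show False using ij pos by (simp add: SE_corners_def)
    qed
    moreover have "colored n r q (i, j)" using c1 colored_shift(1) by blast
    ultimately show "(i, j) \<in> NW_corners n r q D"
      using ij by (auto simp: NW_corners_def colored_def content_def)
  qed
qed

text \<open>
  Stepping one cell to the right maps the cells of color \<open>q + 1\<close> that are not SE corners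
  bijectively onto the cells of color \<open>q\<close> that are not NW corners. By the hypothesis a cell of
  either kind has no neighbour below, respectively above, because such a pair would have other
  colors. As it is not a corner, it has one to the right, respectively to the left.
\<close>

lemma card_noncorners_eq:
  assumes "n > 1" "skew_shape D"
    and "\<And>i j. (i, j) \<in> D \<Longrightarrow> (Suc i, j) \<in> D \<Longrightarrow> (i, j) \<in> NW_corners n r q D"
  shows "card {s \<in> D. colored n r q s \<and> s \<notin> NW_corners n r q D} =
    card {s \<in> D. colored n r (q + 1) s \<and> s \<notin> SE_corners n r (q + 1) D}"
proof -
  have SE: "(Suc i, j) \<in> SE_corners n r (q + 1) D" if "(i, j) \<in> D" "(Suc i, j) \<in> D" for i j
    using column_pairs_at_corners[OF assms(1,2), of r q] assms(3) that by blast
  let ?L = "{s \<in> D. colored n r (q + 1) s \<and> s \<notin> SE_corners n r (q + 1) D}"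
  let ?R = "{s \<in> D. colored n r q s \<and> s \<notin> NW_corners n r q D}"
  have "bij_betw (\<lambda>(i, j). (i, Suc j)) ?L ?R"
  proof (rule bij_betw_byWitness[where f' = "\<lambda>(i, j). (i, j - 1)"])
    show "\<forall>a\<in>?L. (case case a of (i, j) \<Rightarrow> (i, Suc j) of (i, j) \<Rightarrow> (i, j - 1)) = a" by auto
    show "\<forall>a\<in>?R. (case case a of (i, j) \<Rightarrow> (i, j - 1) of (i, j) \<Rightarrow> (i, Suc j)) = a"
      using skew_shapeD(3)[OF assms(2)] by force
    show "(\<lambda>(i, j). (i, Suc j)) ` ?L \<subseteq> ?R"
    proof (intro image_subsetI)
      fix s assume s: "s \<in> ?L"
      obtain i j where ij: "s = (i, j)" by (cases s)
      have D: "(i, j) \<in> D" and c: "colored n r (q + 1) (i, j)"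
        and nse: "(i, j) \<notin> SE_corners n r (q + 1) D" using s ij by auto
      have "(Suc i, j) \<notin> D"
      proof
        assume "(Suc i, j) \<in> D"
        then have "colored n r (q + 1) (Suc i, j)"
          using SE[OF D] by (simp add: SE_corners_iff[OF assms(2)])
        then show False using c colored_neighbours(1)[OF assms(1)] by blast
      qed
      then have "(i, Suc j) \<in> D" using D c nse by (auto simp: SE_corners_def colored_def content_def)
      moreover have "(i, Suc j) \<notin> NW_corners n r q D" using D by (auto simp: NW_corners_def)
      moreover have "colored n r q (i, Suc j)" using c colored_shift(2) by blast
      ultimately show "(case s of (i, j) \<Rightarrow> (i, Suc j)) \<in> ?R" using ij by simp
    qed
    show "(\<lambda>(i, j). (i, j - 1)) ` ?R \<subseteq> ?L"
    proof (intro image_subsetI)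
      fix s assume s: "s \<in> ?R"
      obtain i j where ij: "s = (i, j)" by (cases s)
      have D: "(i, j) \<in> D" and c: "colored n r q (i, j)"
        and nnw: "(i, j) \<notin> NW_corners n r q D" using s ij by auto
      have pos: "0 < i" "0 < j" using D skew_shapeD(2,3)[OF assms(2)] by blast+
      have "(i - 1, j) \<notin> D"
      proof
        assume u: "(i - 1, j) \<in> D"
        then have "colored n r q (i - 1, j)"
          using assms(3)[OF u] D pos by (simp add: NW_corners_iff[OF assms(2)])
        then show False using c colored_neighbours(1)[OF assms(1), of r q "i - 1" j] pos by simp
      qed
      then have "(i, j - 1) \<in> D" using D c nnw by (auto simp: NW_corners_def colored_def content_def)
      moreover have "(i, j - 1) \<notin> SE_corners n r (q + 1) D" using D pos by (auto simp: SE_corners_def)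
      moreover have "colored n r (q + 1) (i, j - 1)"
        using c pos colored_shift(2)[of n r q i "j - 1"] by simp
      ultimately show "(case s of (i, j) \<Rightarrow> (i, j - 1)) \<in> ?L" using ij by simp
    qed
  qed
  then show ?thesis by (simp add: bij_betw_same_card)
qed

text \<open>
  The condition \<open>V \<subseteq> A\<close> in the sum over subsets \<open>A\<close> is imposed by replacing \<open>g\<close> by 0 on \<open>V\<close>; the
  sum is then an expanded product of binomials.
\<close>

lemma sum_supersets_prod:
  fixes f g :: "'a \<Rightarrow> 'k::comm_semiring_1"
  assumes "finite P"
  shows "(\<Sum>A\<in>Pow P. if V \<subseteq> A then (\<Prod>s\<in>A. f s) * (\<Prod>s\<in>P - A. g s) else 0) =
    (if V \<subseteq> P then (\<Prod>s\<in>P. if s \<in> V then f s else f s + g s) else 0)"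
proof (cases "V \<subseteq> P")
  case True
  have "(\<Sum>A\<in>Pow P. if V \<subseteq> A then (\<Prod>s\<in>A. f s) * (\<Prod>s\<in>P - A. g s) else 0)
     = (\<Sum>A\<in>Pow P. (\<Prod>s\<in>A. f s) * (\<Prod>s\<in>P - A. if s \<in> V then 0 else g s))"
  proof (intro sum.cong refl)
    fix A assume A: "A \<in> Pow P"
    show "(if V \<subseteq> A then (\<Prod>s\<in>A. f s) * (\<Prod>s\<in>P - A. g s) else 0) =
        (\<Prod>s\<in>A. f s) * (\<Prod>s\<in>P - A. if s \<in> V then 0 else g s)"
    proof (cases "V \<subseteq> A")
      case True
      then have "(\<Prod>s\<in>P - A. if s \<in> V then 0 else g s) = (\<Prod>s\<in>P - A. g s)"
        by (intro prod.cong) auto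
      then show ?thesis using True by simp
    next
      case False
      then have "\<exists>s\<in>P - A. (if s \<in> V then 0 else g s) = 0" using \<open>V \<subseteq> P\<close> by auto
      then have "(\<Prod>s\<in>P - A. if s \<in> V then 0 else g s) = 0"
        using assms by (intro prod_zero) auto
      then show ?thesis using False by simp
    qed
  qed
  also have "\<dots> = (\<Prod>s\<in>P. f s + (if s \<in> V then 0 else g s))"
    by (rule prod_add[OF assms, symmetric])
  also have "\<dots> = (\<Prod>s\<in>P. if s \<in> V then f s else f s + g s)" by (intro prod.cong) auto
  finally show ?thesis using True by simp
next
  case False
  then have "\<not> V \<subseteq> A" if "A \<in> Pow P" for A using that by auto
  then show ?thesis using False by (auto intro!: sum.neutral)
qed

text \<open>
  Removing NW corners leaves a horizontal strip if and only if the removed set contains the set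
  \<open>V\<close> of the upper cells of all vertical pairs; likewise for SE corners and the set \<open>W\<close> of the
  lower cells. So both sides vanish unless \<open>V\<close> and \<open>W\<close> consist of corners of the right color,
  and these two conditions are equivalent. If they hold, then both sides are expanded products,
  and both equal \<open>(1 - c)\<^bsup>|V|\<^esup> c\<^bsup>-|S|\<^esup>\<close> times the product of \<open>w\<close> over \<open>D\<close>, where \<open>S\<close> is the set of
  SE corners of color \<open>q + 1\<close>. On the left a NW corner of color \<open>q\<close> outside \<open>V\<close> contributes \<open>c w
  - (c - 1) w = w\<close>, and the remaining factors \<open>c\<close> and \<open>c\<^sup>-\<^sup>1\<close> cancel in pairs by
  \<open>card_noncorners_eq\<close> except for one \<open>c\<^sup>-\<^sup>1\<close> at each cell of \<open>S\<close>. On the right a cell of \<open>S\<close>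
  outside \<open>W\<close> contributes \<open>w + (c\<^sup>-\<^sup>1 - 1) w = c\<^sup>-\<^sup>1 w\<close>, and a cell of \<open>W\<close> contributes \<open>(c\<^sup>-\<^sup>1 - 1) w
  = (1 - c) c\<^sup>-\<^sup>1 w\<close>.
\<close>

lemma strip_exchange:
  fixes w w' :: "int \<Rightarrow> 'k::field"
  assumes n: "n > 1" and D: "skew_shape D" and c: "c \<noteq> 0"
    and periodic: "\<And>a b. a mod int n = b mod int n \<Longrightarrow> w a = w b"
    and w': "\<And>a. w' a = (if a mod int n = q mod int n then c * w a
        else if a mod int n = (q + 1) mod int n then inverse c * w a else w a)"
  shows "conv (patch n r q (- ((c - 1) * w q))) (strip r w') D =
    conv (strip r w) (patch n r (q + 1) ((inverse c - 1) * w (q + 1))) D"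
proof -
  have fin: "finite D" using D by (rule skew_shapeD)
  define \<omega> \<omega>' where "\<omega> s = w (content s + r)" and "\<omega>' s = w' (content s + r)" for s
  define P where "P = NW_corners n r q D"
  define S where "S = SE_corners n r (q + 1) D"
  define V where "V = {s\<in>D. (Suc (fst s), snd s) \<in> D}"
  define W where "W = (\<lambda>s. (Suc (fst s), snd s)) ` V"
  have PD: "P \<subseteq> D" and SD: "S \<subseteq> D" using NW_corners_subset SE_corners_subset by (auto simp: P_def S_def)
  have finP: "finite P" and finS: "finite S" using PD SD fin finite_subset by auto
  have VD: "V \<subseteq> D" and WD: "W \<subseteq> D" by (auto simp: V_def W_def)
  have cardW: "card W = card V"
    unfolding W_def by (rule card_image) (auto simp: inj_on_def prod_eq_iff)
  have P_col: "colored n r q s" if "s \<in> P" for s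
    using that by (cases s) (simp add: P_def NW_corners_iff[OF D])
  have S_col: "colored n r (q + 1) s" if "s \<in> S" for s
    using that by (cases s) (simp add: S_def SE_corners_iff[OF D])
  have not_both: "\<not> colored n r (q + 1) s" if "colored n r q s" for s
  proof -
    obtain i j where s: "s = (i, j)" by (cases s)
    have "colored n r (q + 1) (Suc i, j)" using that colored_shift(1)[of n r q i j] s by simp
    then show ?thesis using colored_neighbours(1)[OF n, of r "q + 1" i j] s by blast
  qed
  have \<omega>_q: "\<omega> s = w q" if "colored n r q s" for s
    using that unfolding \<omega>_def colored_def by (rule periodic)
  have \<omega>_q1: "\<omega> s = w (q + 1)" if "colored n r (q + 1) s" for s
    using that unfolding \<omega>_def colored_def by (rule periodic)
  have \<omega>': "\<omega>' s = (if colored n r q s then c else 1) *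
      (if colored n r (q + 1) s then inverse c else 1) * \<omega> s" for s
    using not_both[of s] by (auto simp: \<omega>'_def \<omega>_def w' colored_def)
  have strip_remove_P: "strip r w' (D - A) = (if V \<subseteq> A then \<Prod>s\<in>D - A. \<omega>' s else 0)" if "A \<subseteq> P" for A
  proof -
    have "(\<exists>i j. (i, j) \<in> D - A \<and> (Suc i, j) \<in> D - A) \<longleftrightarrow> \<not> V \<subseteq> A"
    proof -
      have "(Suc i, j) \<notin> A" if "(i, j) \<in> D" for i j
        using that \<open>A \<subseteq> P\<close> by (auto simp: P_def NW_corners_def)
      then show ?thesis by (auto simp: V_def)
    qed
    then show ?thesis by (auto simp: strip_def \<omega>'_def)
  qed
  have strip_remove_S: "strip r w (D - B) = (if W \<subseteq> B then \<Prod>s\<in>D - B. \<omega> s else 0)" if "B \<subseteq> S" for B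
  proof -
    have "(\<exists>i j. (i, j) \<in> D - B \<and> (Suc i, j) \<in> D - B) \<longleftrightarrow> \<not> W \<subseteq> B"
    proof -
      have "(i, j) \<notin> B" if "(Suc i, j) \<in> D" for i j
        using that \<open>B \<subseteq> S\<close> by (auto simp: S_def SE_corners_def)
      then show ?thesis by (auto simp: V_def W_def image_subset_iff)
    qed
    then show ?thesis by (auto simp: strip_def \<omega>_def)
  qed
  have split_prod: "(\<Prod>s\<in>D - A. h s) = (\<Prod>s\<in>X - A. h s) * (\<Prod>s\<in>D - X. h s)"
    if "A \<subseteq> X" "X \<subseteq> D" for A X and h :: "nat \<times> nat \<Rightarrow> 'k"
  proof -
    have "D - A = (X - A) \<union> (D - X)" using that by auto
    then show ?thesis using that fin finite_subset[OF that(2) fin]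
      by (simp only:) (rule prod.union_disjoint, auto)
  qed
  have "conv (patch n r q (- ((c - 1) * w q))) (strip r w') D
      = (\<Sum>A\<in>Pow P. (- ((c - 1) * w q)) ^ card A * strip r w' (D - A))"
    unfolding P_def by (rule conv_patch_left[OF n D])
  also have "\<dots> = (\<Sum>A\<in>Pow P. (if V \<subseteq> A then (\<Prod>s\<in>A. (1 - c) * \<omega> s) * (\<Prod>s\<in>P - A. \<omega>' s) else 0)
      * (\<Prod>s\<in>D - P. \<omega>' s))"
  proof (intro sum.cong refl)
    fix A assume A: "A \<in> Pow P"
    have "(\<Prod>s\<in>A. (1 - c) * \<omega> s) = (\<Prod>s\<in>A. - ((c - 1) * w q))"
      using A P_col \<omega>_q by (intro prod.cong) (auto simp: algebra_simps)
    then show "(- ((c - 1) * w q)) ^ card A * strip r w' (D - A) =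
       (if V \<subseteq> A then (\<Prod>s\<in>A. (1 - c) * \<omega> s) * (\<Prod>s\<in>P - A. \<omega>' s) else 0) * (\<Prod>s\<in>D - P. \<omega>' s)"
      using strip_remove_P[of A] split_prod[of A P \<omega>'] A PD by simp
  qed
  also have "\<dots> = (if V \<subseteq> P then (\<Prod>s\<in>P. if s \<in> V then (1 - c) * \<omega> s else (1 - c) * \<omega> s + \<omega>' s) else 0)
      * (\<Prod>s\<in>D - P. \<omega>' s)"
    by (simp only: sum_distrib_right[symmetric] sum_supersets_prod[OF finP])
  also have "\<dots> = (if V \<subseteq> P then (1 - c) ^ card V * (\<Prod>s\<in>D. \<omega> s) * inverse c ^ card S else 0)"
  proof (cases "V \<subseteq> P")
    case True
    have "(\<Prod>s\<in>P. if s \<in> V then (1 - c) * \<omega> s else (1 - c) * \<omega> s + \<omega>' s)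
        = (\<Prod>s\<in>P. (if s \<in> V then 1 - c else 1) * \<omega> s)"
      using P_col not_both by (intro prod.cong) (auto simp: \<omega>' algebra_simps)
    also have "\<dots> = (1 - c) ^ card V * (\<Prod>s\<in>P. \<omega> s)"
      using True finP by (simp add: prod.distrib prod.If_cases Int_absorb1)
    finally have 1: "(\<Prod>s\<in>P. if s \<in> V then (1 - c) * \<omega> s else (1 - c) * \<omega> s + \<omega>' s)
        = (1 - c) ^ card V * (\<Prod>s\<in>P. \<omega> s)" .
    have pair: "(i, j) \<in> NW_corners n r q D" if "(i, j) \<in> D" "(Suc i, j) \<in> D" for i j
      using True that by (auto simp: P_def V_def)
    have "(\<Prod>s\<in>D - P. \<omega>' s) = c ^ card {s\<in>D - P. colored n r q s} *
        inverse c ^ card {s\<in>D - P. colored n r (q + 1) s} * (\<Prod>s\<in>D - P. \<omega> s)"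
      using fin by (simp add: \<omega>' prod.distrib prod.If_cases Int_def)
    also have "{s\<in>D - P. colored n r (q + 1) s} = S \<union> {s\<in>D. colored n r (q + 1) s \<and> s \<notin> S}"
      using SD S_col P_col not_both by blast
    also have "card \<dots> = card S + card {s\<in>D. colored n r (q + 1) s \<and> s \<notin> S}"
      using finS fin by (intro card_Un_disjoint) auto
    also have "card {s\<in>D. colored n r (q + 1) s \<and> s \<notin> S} = card {s\<in>D - P. colored n r q s}"
    proof -
      have "{s\<in>D - P. colored n r q s} = {s \<in> D. colored n r q s \<and> s \<notin> P}" by auto
      then show ?thesis using card_noncorners_eq[OF n D pair] by (simp add: P_def S_def)
    qed
    finally have 2: "(\<Prod>s\<in>D - P. \<omega>' s) = inverse c ^ card S * (\<Prod>s\<in>D - P. \<omega> s)"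
      using c by (simp add: power_add power_inverse field_simps)
    have "(\<Prod>s\<in>D. \<omega> s) = (\<Prod>s\<in>P. \<omega> s) * (\<Prod>s\<in>D - P. \<omega> s)"
      using split_prod[of "{}" P \<omega>] PD by simp
    then show ?thesis using True 1 2 by simp
  qed simp
  also have "V \<subseteq> P \<longleftrightarrow> W \<subseteq> S"
  proof -
    have "V \<subseteq> P \<longleftrightarrow> (\<forall>i j. (i, j) \<in> D \<longrightarrow> (Suc i, j) \<in> D \<longrightarrow> (i, j) \<in> NW_corners n r q D)"
      by (auto simp: V_def P_def)
    moreover have "W \<subseteq> S \<longleftrightarrow> (\<forall>i j. (i, j) \<in> D \<longrightarrow> (Suc i, j) \<in> D \<longrightarrow> (Suc i, j) \<in> SE_corners n r (q + 1) D)"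
      by (auto simp: V_def W_def S_def image_subset_iff)
    ultimately show ?thesis using column_pairs_at_corners[OF n D, of r q] by simp
  qed
  also have "(if W \<subseteq> S then (1 - c) ^ card V * (\<Prod>s\<in>D. \<omega> s) * inverse c ^ card S else 0)
      = (if W \<subseteq> S then (\<Prod>s\<in>S. if s \<in> W then (inverse c - 1) * \<omega> s else (inverse c - 1) * \<omega> s + \<omega> s) else 0)
      * (\<Prod>s\<in>D - S. \<omega> s)"
  proof (cases "W \<subseteq> S")
    case True
    have "(\<Prod>s\<in>S. if s \<in> W then (inverse c - 1) * \<omega> s else (inverse c - 1) * \<omega> s + \<omega> s)
        = (\<Prod>s\<in>S. (if s \<in> W then 1 - c else 1) * (inverse c * \<omega> s))"
      using c by (intro prod.cong) (auto simp: field_simps)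
    also have "\<dots> = (1 - c) ^ card W * (inverse c ^ card S * (\<Prod>s\<in>S. \<omega> s))"
      using True finS by (simp add: prod.distrib prod.If_cases Int_absorb1)
    finally have "(\<Prod>s\<in>S. if s \<in> W then (inverse c - 1) * \<omega> s else (inverse c - 1) * \<omega> s + \<omega> s)
        = (1 - c) ^ card W * (inverse c ^ card S * (\<Prod>s\<in>S. \<omega> s))" .
    moreover have "(\<Prod>s\<in>D. \<omega> s) = (\<Prod>s\<in>S. \<omega> s) * (\<Prod>s\<in>D - S. \<omega> s)"
      using split_prod[of "{}" S \<omega>] SD by simp
    ultimately show ?thesis using True cardW by simp
  qed simp
  also have "\<dots> = (\<Sum>B\<in>Pow S. (if W \<subseteq> B then (\<Prod>s\<in>B. (inverse c - 1) * \<omega> s) * (\<Prod>s\<in>S - B. \<omega> s) else 0)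
      * (\<Prod>s\<in>D - S. \<omega> s))"
    by (simp only: sum_distrib_right[symmetric] sum_supersets_prod[OF finS])
  also have "\<dots> = (\<Sum>B\<in>Pow S. strip r w (D - B) * ((inverse c - 1) * w (q + 1)) ^ card B)"
  proof (intro sum.cong refl)
    fix B assume B: "B \<in> Pow S"
    have "(\<Prod>s\<in>B. (inverse c - 1) * \<omega> s) = (\<Prod>s\<in>B. (inverse c - 1) * w (q + 1))"
      using B S_col \<omega>_q1 by (intro prod.cong) auto
    then show "(if W \<subseteq> B then (\<Prod>s\<in>B. (inverse c - 1) * \<omega> s) * (\<Prod>s\<in>S - B. \<omega> s) else 0) * (\<Prod>s\<in>D - S. \<omega> s)
        = strip r w (D - B) * ((inverse c - 1) * w (q + 1)) ^ card B"
      using strip_remove_S[of B] split_prod[of B S \<omega>] B SD by simp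
  qed
  also have "\<dots> = conv (strip r w) (patch n r (q + 1) ((inverse c - 1) * w (q + 1))) D"
    unfolding S_def by (rule conv_patch_right[OF n D, symmetric])
  finally show ?thesis .
qed

section \<open>The crystal operators on loop skew Schur functions\<close>

lemma loop_schur_cong:
  assumes "\<And>i. 1 \<le> i \<Longrightarrow> i \<le> m \<Longrightarrow> x i = y i"
  shows "loop_schur m r D x = loop_schur m r D y"
  unfolding loop_schur_def
proof (intro sum.cong prod.cong refl)
  fix T s assume "T \<in> ssyt m D" "s \<in> D"
  then have "T s \<in> {1..m}" by (auto simp: ssyt_def)
  then show "x (T s) (content s + r) = y (T s) (content s + r)" using assms by simp
qed

lemma loop_schur_1:
  assumes "skew_shape D"
  shows "loop_schur (Suc 0) r D x = strip r (x 1) D"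
proof -
  have "loop_schur (Suc 0) r D x = conv (\<lambda>E. loop_schur 0 r E x) (strip r (x 1)) D"
    using loop_schur_Suc[OF assms, of 0 r x] by simp
  also have "\<dots> = conv unit_shape (strip r (x 1)) D"
    using assms by (intro conv_cong_skew) (auto intro: loop_schur_0 skew_shapeD)
  finally show ?thesis by (simp add: conv_unit_left skew_shapeD(1)[OF assms])
qed

definition periodic :: "nat \<Rightarrow> (nat \<Rightarrow> int \<Rightarrow> 'k) \<Rightarrow> bool"
  where "periodic n x \<longleftrightarrow> (\<forall>i a b. a mod int n = b mod int n \<longrightarrow> x i a = x i b)"

lemma periodicD: "periodic n x \<Longrightarrow> a mod int n = b mod int n \<Longrightarrow> x i a = x i b"
  unfolding periodic_def by blast

lemma act_basic_crystal:
  "act (basic_crystal n i) k c x a = (if a mod int n = (k + int i - 1) mod int n then c * x a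
    else if a mod int n = (k + int i) mod int n then inverse c * x a else x a)"
  by (simp add: basic_crystal_def)

text \<open>
  In the shifted coordinates of the factor \<open>X\<^sub>i\<^sub>+\<^sub>1\<close> the operator \<open>e\<^sub>k\<close> changes the coordinates of
  colors \<open>q = k + i\<close> and \<open>q + 1\<close>, so the color of the patch grows by one with each factor it
  passes.
\<close>

lemma strip_act:
  fixes x :: "int \<Rightarrow> 'k::field"
  assumes "n > 1" "skew_shape D" "c \<noteq> 0" "\<And>a b. a mod int n = b mod int n \<Longrightarrow> x a = x b"
  shows "conv (patch n r (k + int i) (- ((c - 1) * x (k + int i))))
      (strip r (act (basic_crystal n (Suc i)) k c x)) D =
    conv (strip r x) (patch n r (k + int (Suc i)) ((inverse c - 1) * x (k + int (Suc i)))) D"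
proof -
  have eqs: "k + int (Suc i) - 1 = k + int i" "k + int i + 1 = k + int (Suc i)" by simp_all
  have "conv (patch n r (k + int i) (- ((c - 1) * x (k + int i))))
      (strip r (act (basic_crystal n (Suc i)) k c x)) D =
    conv (strip r x) (patch n r (k + int i + 1) ((inverse c - 1) * x (k + int i + 1))) D"
    by (rule strip_exchange[OF assms]) (simp_all only: act_basic_crystal eqs)
  then show ?thesis by (simp only: eqs)
qed

lemma crystal_X_1:
  "eps (crystal_X n (Suc 0)) k x = x 1 (k + 1)"
  "phi (crystal_X n (Suc 0)) k x = x 1 k"
  "act (crystal_X n (Suc 0)) k c x = x(1 := act (basic_crystal n 1) k c (x 1))"
  by (simp_all add: transport_def basic_crystal_def)

lemma crystal_X_Suc:
  fixes x :: "nat \<Rightarrow> int \<Rightarrow> 'k::field" and k :: int and n m :: nat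
  assumes "m \<ge> 1"
  defines "e \<equiv> eps (crystal_X n m) k x" and "f \<equiv> phi (crystal_X n m) k x"
    and "p \<equiv> x (Suc m) (k + int m)" and "q \<equiv> x (Suc m) (k + int (Suc m))"
  shows "eps (crystal_X n (Suc m)) k x = e * q / (p + e)"
    and "phi (crystal_X n (Suc m)) k x = f * p / (e + p)"
    and "act (crystal_X n (Suc m)) k c x =
      (act (crystal_X n m) k ((c * p + e) / (p + e)) x)
        (Suc m := act (basic_crystal n (Suc m)) k (c / ((c * p + e) / (p + e))) (x (Suc m)))"
proof -
  obtain l where m: "m = Suc l" using assms by (cases m) auto
  have p: "p = x (Suc (Suc l)) (k + int (Suc (Suc l)) - 1)" by (simp add: p_def m ac_simps)
  show "eps (crystal_X n (Suc m)) k x = e * q / (p + e)"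
    unfolding p e_def q_def m by (simp add: transport_def prod_crystal_def basic_crystal_def)
  show "phi (crystal_X n (Suc m)) k x = f * p / (e + p)"
    unfolding p e_def f_def m by (simp add: transport_def prod_crystal_def basic_crystal_def)
  show "act (crystal_X n (Suc m)) k c x =
      (act (crystal_X n m) k ((c * p + e) / (p + e)) x)
        (Suc m := act (basic_crystal n (Suc m)) k (c / ((c * p + e) / (p + e))) (x (Suc m)))"
    unfolding p e_def m
    by (simp add: transport_def prod_crystal_def c_plus_def)
      (simp add: basic_crystal_def)
qed

text \<open>
  No denominator vanishes when \<open>e\<^sub>k\<close> with parameter \<open>c\<close> is evaluated at \<open>x\<close>. The parameter is
  passed on to the first \<open>m\<close> factors as \<open>c\<^sup>+\<close>, whose numerator must not vanish either, since the
  last factor is acted on with \<open>c / c\<^sup>+\<close>.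
\<close>

inductive act_defined :: "nat \<Rightarrow> int \<Rightarrow> (nat \<Rightarrow> int \<Rightarrow> 'k::field) \<Rightarrow> nat \<Rightarrow> 'k \<Rightarrow> bool"
  for n k x where
    one: "c \<noteq> 0 \<Longrightarrow> act_defined n k x (Suc 0) c"
  | Suc: "\<lbrakk>m \<ge> 1; c \<noteq> 0; p = x (Suc m) (k + int m); e = eps (crystal_X n m) k x;
      p + e \<noteq> 0; c * p + e \<noteq> 0; act_defined n k x m ((c * p + e) / (p + e))\<rbrakk>
      \<Longrightarrow> act_defined n k x (Suc m) c"

lemma act_basic_crystal_periodic:
  assumes "x a = x b" "a mod int n = b mod int n"
  shows "act (basic_crystal n i) k c x a = act (basic_crystal n i) k c x b"
  using assms by (simp add: act_basic_crystal)

lemma periodic_update_act: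
  assumes "periodic n x" "periodic n y"
  shows "periodic n (y(j := act (basic_crystal n j) k c (x j)))"
  unfolding periodic_def
proof (intro allI impI)
  fix i a b assume ab: "a mod int n = b mod int n"
  show "(y(j := act (basic_crystal n j) k c (x j))) i a = (y(j := act (basic_crystal n j) k c (x j))) i b"
    using act_basic_crystal_periodic[OF periodicD[OF assms(1) ab, of j] ab] periodicD[OF assms(2) ab, of i]
    by (cases "i = j") simp_all
qed

lemma periodic_act:
  assumes "m \<ge> 1" "periodic n x"
  shows "periodic n (act (crystal_X n m) k c x)"
  using assms(1)
proof (induction m arbitrary: c rule: nat_induct_at_least)
  case base
  show ?case
    unfolding One_nat_def crystal_X_1(3) by (rule periodic_update_act[OF assms(2,2), unfolded One_nat_def])
next
  case (Suc m)
  show ?case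
    unfolding crystal_X_Suc(3)[OF Suc.hyps] by (rule periodic_update_act[OF assms(2) Suc.IH])
qed

text \<open>
  Induction on the number of factors. The patch to the right of the first \<open>m\<close> variables, which
  the induction hypothesis produces, is \<open>patch n r (k + int m) (- ((c\<^sub>2 - 1) * p))\<close>, so
  \<open>strip_act\<close> carries it across the last variable.
\<close>

lemma loop_schur_act:
  fixes x :: "nat \<Rightarrow> int \<Rightarrow> 'k::field"
  assumes n: "n > 1" and x: "periodic n x" and "act_defined n k x m c" and "skew_shape D"
  shows "loop_schur m r D (act (crystal_X n m) k c x) =
    conv (patch n r k ((c - 1) * phi (crystal_X n m) k x))
      (conv (\<lambda>E. loop_schur m r E x)
        (patch n r (k + int m) ((inverse c - 1) * eps (crystal_X n m) k x))) D"
  using assms(3,4)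
proof (induction arbitrary: D rule: act_defined.induct)
  case (one c)
  have per: "x 1 a = x 1 b" if "a mod int n = b mod int n" for a b
    by (rule periodicD[OF x that])
  let ?\<alpha> = "(c - 1) * x 1 k"
  let ?B = "patch n r (k + 1) ((inverse c - 1) * x 1 (k + 1))"
  let ?w' = "act (basic_crystal n 1) k c (x 1)"
  have fin: "finite D" using one.prems by (rule skew_shapeD)
  have "loop_schur (Suc 0) r D (act (crystal_X n (Suc 0)) k c x) = strip r ?w' D"
    by (simp only: loop_schur_1[OF one.prems] crystal_X_1) simp
  also have "\<dots> = conv unit_shape (strip r ?w') D"
    by (simp add: conv_unit_left fin)
  \<comment> \<open>Insert a patch and its inverse, to which the exchange relation applies.\<close>
  also have "\<dots> = conv (conv (patch n r k ?\<alpha>) (patch n r k (- ?\<alpha>))) (strip r ?w') D"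
    using one.prems by (intro conv_cong_skew) (simp_all add: conv_patch_inverse[OF n])
  also have "\<dots> = conv (patch n r k ?\<alpha>) (conv (patch n r k (- ?\<alpha>)) (strip r ?w')) D"
    by (rule conv_assoc[OF fin])
  also have "\<dots> = conv (patch n r k ?\<alpha>) (conv (strip r (x 1)) ?B) D"
  proof (rule conv_cong_skew[OF one.prems refl])
    fix E assume E: "skew_shape E"
    have "conv (patch n r (k + int 0) (- ((c - 1) * x 1 (k + int 0))))
        (strip r (act (basic_crystal n (Suc 0)) k c (x 1))) E =
      conv (strip r (x 1)) (patch n r (k + int (Suc 0)) ((inverse c - 1) * x 1 (k + int (Suc 0)))) E"
      by (rule strip_act[OF n E one.hyps per])
    then show "conv (patch n r k (- ?\<alpha>)) (strip r ?w') E = conv (strip r (x 1)) ?B E" by simp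
  qed
  also have "\<dots> = conv (patch n r k ?\<alpha>) (conv (\<lambda>E. loop_schur (Suc 0) r E x) ?B) D"
    using one.prems by (intro conv_cong_skew) (simp_all add: loop_schur_1)
  finally show ?case by (simp only: crystal_X_1) simp
next
  case (Suc m c p e)
  have per: "x (Suc m) a = x (Suc m) b" if "a mod int n = b mod int n" for a b
    by (rule periodicD[OF x that])
  define f where "f = phi (crystal_X n m) k x"
  define q where "q = x (Suc m) (k + int (Suc m))"
  define c\<^sub>1 where "c\<^sub>1 = (c * p + e) / (p + e)"
  define c\<^sub>2 where "c\<^sub>2 = c / c\<^sub>1"
  have c12: "c\<^sub>1 \<noteq> 0" "c\<^sub>2 \<noteq> 0" using Suc.hyps by (simp_all add: c\<^sub>1_def c\<^sub>2_def)
  have ph: "(c\<^sub>1 - 1) * f = (c - 1) * phi (crystal_X n (Suc m)) k x"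
    using Suc.hyps(5) unfolding crystal_X_Suc(2)[OF Suc.hyps(1)] f_def[symmetric]
      Suc.hyps(3,4)[symmetric] c\<^sub>1_def by (simp add: field_simps)
  \<comment> \<open>This is where the definition of \<open>c\<^sup>+\<close> enters: the two inner patches match.\<close>
  have mid: "(inverse c\<^sub>1 - 1) * e = - ((c\<^sub>2 - 1) * p)"
    using Suc.hyps(2,5,6) unfolding c\<^sub>1_def c\<^sub>2_def by (simp add: field_simps)
  have ep: "(inverse c\<^sub>2 - 1) * q = (inverse c - 1) * eps (crystal_X n (Suc m)) k x"
  proof -
    have "inverse c\<^sub>2 - 1 = (inverse c - 1) * (e / (p + e))"
    proof -
      have "(c * p + e) / (p + e) - c = (1 - c) * (e / (p + e))"
        using Suc.hyps(5) by (simp add: field_simps)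
      moreover have "inverse c\<^sub>2 - 1 = inverse c * ((c * p + e) / (p + e) - c)"
        using Suc.hyps(2) unfolding c\<^sub>2_def c\<^sub>1_def by (simp add: right_diff_distrib divide_inverse mult_ac)
      ultimately show ?thesis using Suc.hyps(2) by (simp add: left_diff_distrib right_diff_distrib)
    qed
    then show ?thesis unfolding crystal_X_Suc(1)[OF Suc.hyps(1)] q_def[symmetric]
      Suc.hyps(3,4)[symmetric] by (simp add: mult_ac)
  qed
  let ?A = "patch n r k ((c - 1) * phi (crystal_X n (Suc m)) k x)"
  let ?M = "patch n r (k + int m) (- ((c\<^sub>2 - 1) * p))"
  let ?B = "patch n r (k + int (Suc m)) ((inverse c - 1) * eps (crystal_X n (Suc m)) k x)"
  let ?S = "\<lambda>E. loop_schur m r E x"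
  let ?z = "act (basic_crystal n (Suc m)) k c\<^sub>2 (x (Suc m))"
  have fin: "finite D" using Suc.prems by (rule skew_shapeD)
  have act: "act (crystal_X n (Suc m)) k c x = (act (crystal_X n m) k c\<^sub>1 x)(Suc m := ?z)"
    unfolding crystal_X_Suc(3)[OF Suc.hyps(1)] c\<^sub>1_def c\<^sub>2_def Suc.hyps(3,4) ..
  have "loop_schur (Suc m) r D (act (crystal_X n (Suc m)) k c x) =
      conv (\<lambda>E. loop_schur m r E ((act (crystal_X n m) k c\<^sub>1 x)(Suc m := ?z))) (strip r ?z) D"
    unfolding act loop_schur_Suc[OF Suc.prems] by simp
  also have "\<dots> = conv (conv ?A (conv ?S ?M)) (strip r ?z) D"
  proof (rule conv_cong_skew[OF Suc.prems])
    fix E assume E: "skew_shape E"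
    have "loop_schur m r E ((act (crystal_X n m) k c\<^sub>1 x)(Suc m := ?z)) =
        loop_schur m r E (act (crystal_X n m) k c\<^sub>1 x)"
      by (rule loop_schur_cong) simp
    also have "\<dots> = conv ?A (conv ?S ?M) E"
      using Suc.IH[OF E] by (simp only: c\<^sub>1_def[symmetric] f_def[symmetric] ph Suc.hyps(4)[symmetric] mid)
    finally show "loop_schur m r E ((act (crystal_X n m) k c\<^sub>1 x)(Suc m := ?z)) =
        conv ?A (conv ?S ?M) E" .
  qed simp
  also have "\<dots> = conv ?A (conv (conv ?S ?M) (strip r ?z)) D"
    by (rule conv_assoc[OF fin])
  also have "\<dots> = conv ?A (conv (conv ?S (strip r (x (Suc m)))) ?B) D"
  proof (rule conv_cong_skew[OF Suc.prems refl])
    fix E assume E: "skew_shape E"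
    then have finE: "finite E" by (rule skew_shapeD)
    have "conv (conv ?S ?M) (strip r ?z) E = conv ?S (conv ?M (strip r ?z)) E"
      by (rule conv_assoc[OF finE])
    also have "\<dots> = conv ?S (conv (strip r (x (Suc m))) ?B) E"
    proof (rule conv_cong_skew[OF E refl])
      fix F assume F: "skew_shape F"
      have "conv ?M (strip r ?z) F = conv (strip r (x (Suc m)))
          (patch n r (k + int (Suc m)) ((inverse c\<^sub>2 - 1) * q)) F"
        unfolding q_def Suc.hyps(3) by (rule strip_act[OF n F c12(2) per])
      then show "conv ?M (strip r ?z) F = conv (strip r (x (Suc m))) ?B F" by (simp only: ep)
    qed
    also have "\<dots> = conv (conv ?S (strip r (x (Suc m)))) ?B E"
      by (rule conv_assoc[OF finE, symmetric])
    finally show "conv (conv ?S ?M) (strip r ?z) E = conv (conv ?S (strip r (x (Suc m)))) ?B E" .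
  qed
  also have "\<dots> = conv ?A (conv (\<lambda>E. loop_schur (Suc m) r E x) ?B) D"
    using Suc.prems by (intro conv_cong_skew) (simp_all add: loop_schur_Suc)
  finally show ?case .
qed

section \<open>Pullback of rational functions\<close>

lemma cpoly_induct:
  fixes P :: cpoly
  assumes "\<And>t a. Q (Poly_Mapping.single t a)" "\<And>P1 P2. Q P1 \<Longrightarrow> Q P2 \<Longrightarrow> Q (P1 + P2)"
  shows "Q P"
proof (induction P rule: update_induct)
  case const
  show ?case using assms(1)[of 0 0] by simp
next
  case (update f a b)
  have "Poly_Mapping.update a b f = Poly_Mapping.single a b + f"
    using update by (intro poly_mapping_eqI) (auto simp: Poly_Mapping.update.rep_eq lookup_add lookup_single in_keys_iff when_def)
  then show ?case using update assms by simp
qed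

lemma const_simps:
  "const 0 = 0" "const 1 = 1" "const (a + b) = const a + const b" "const (a * b) = const a * const b"
  by (simp_all add: const_def single_add mult_single Zero_fract_def One_fract_def)

lemma const_eq_0_iff: "const a = 0 \<longleftrightarrow> a = 0"
proof -
  have "Poly_Mapping.single 0 a = (0 :: cpoly) \<longleftrightarrow> a = 0"
    by (metis lookup_single_eq lookup_zero single_zero)
  then show ?thesis by (simp add: const_def Zero_fract_def eq_fract)
qed

lemma const_inverse: "const (inverse a) = inverse (const a)"
proof (cases "a = 0")
  case False
  have "const (inverse a) * const a = 1"
    using False by (simp add: const_simps(2,4)[symmetric])
  then show ?thesis by (metis inverse_unique mult.commute)
qed (simp add: const_simps)

definition monomial :: "(nat \<Rightarrow> int \<Rightarrow> ratfun) \<Rightarrow> (nat \<times> int \<Rightarrow>\<^sub>0 nat) \<Rightarrow> ratfun"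
  where "monomial F t = (\<Prod>(i, q)\<in>Poly_Mapping.keys t. F i q ^ Poly_Mapping.lookup t (i, q))"

lemma monomial_superset:
  assumes "finite K" "Poly_Mapping.keys t \<subseteq> K"
  shows "monomial F t = (\<Prod>(i, q)\<in>K. F i q ^ Poly_Mapping.lookup t (i, q))"
  unfolding monomial_def using assms
  by (intro prod.mono_neutral_left) (auto simp: in_keys_iff)

lemma monomial_add: "monomial F (s + t) = monomial F s * monomial F t"
proof -
  let ?K = "Poly_Mapping.keys s \<union> Poly_Mapping.keys t"
  have "monomial F (s + t) = (\<Prod>(i, q)\<in>?K. F i q ^ Poly_Mapping.lookup (s + t) (i, q))"
    by (intro monomial_superset) (auto intro!: Poly_Mapping.keys_add)
  also have "\<dots> = (\<Prod>(i, q)\<in>?K. F i q ^ Poly_Mapping.lookup s (i, q)) *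
      (\<Prod>(i, q)\<in>?K. F i q ^ Poly_Mapping.lookup t (i, q))"
    by (simp add: lookup_add power_add prod.distrib[symmetric] case_prod_unfold)
  also have "\<dots> = monomial F s * monomial F t"
    by (intro arg_cong2[of _ _ _ _ "(*)"] monomial_superset[symmetric]) auto
  finally show ?thesis .
qed

lemma subst_superset:
  assumes "finite K" "Poly_Mapping.keys P \<subseteq> K"
  shows "subst F P = (\<Sum>t\<in>K. const (Poly_Mapping.lookup P t) * monomial F t)"
  unfolding subst_def monomial_def using assms
  by (intro sum.mono_neutral_left) (auto simp: in_keys_iff const_simps)

lemma subst_single: "subst F (Poly_Mapping.single t a) = const a * monomial F t"
  using subst_superset[of "{t}" "Poly_Mapping.single t a" F] by simp

lemma subst_add: "subst F (P + Q) = subst F P + subst F Q"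
proof -
  let ?K = "Poly_Mapping.keys P \<union> Poly_Mapping.keys Q"
  have "subst F (P + Q) = (\<Sum>t\<in>?K. const (Poly_Mapping.lookup (P + Q) t) * monomial F t)"
    by (intro subst_superset) (auto intro!: Poly_Mapping.keys_add)
  also have "\<dots> = (\<Sum>t\<in>?K. const (Poly_Mapping.lookup P t) * monomial F t) +
      (\<Sum>t\<in>?K. const (Poly_Mapping.lookup Q t) * monomial F t)"
    by (simp add: lookup_add const_simps algebra_simps sum.distrib)
  also have "\<dots> = subst F P + subst F Q"
    by (intro arg_cong2[of _ _ _ _ "(+)"] subst_superset[symmetric]) auto
  finally show ?thesis .
qed

lemma subst_mult: "subst F (P * Q) = subst F P * subst F Q"
proof (induction P rule: cpoly_induct)
  case (1 t a)
  show ?case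
    by (induction Q rule: cpoly_induct)
      (simp_all add: mult_single subst_single monomial_add const_simps distrib_left subst_add)
next
  case (2 P1 P2)
  then show ?case by (simp add: distrib_right subst_add)
qed

lemma subst_const: "subst F (Poly_Mapping.single 0 a) = const a"
  by (simp add: subst_single monomial_def)

lemma subst_1: "subst F 1 = 1"
  using subst_const[of F 1] by (simp add: const_simps)

lemma subst_coordinate:
  "subst F (Poly_Mapping.single (Poly_Mapping.single (i, q) 1) 1) = F i q"
  by (simp add: subst_single monomial_def const_simps)

text \<open>
  The graph of \<open>pullback F\<close>, as a relation. It is compatible with the field operations, as far
  as these are defined, and serves two purposes: computing pullbacks, and showing that a
  rational function is nonzero by specializing the coordinates to constants.
\<close>

definition has_pullback :: "(nat \<Rightarrow> int \<Rightarrow> ratfun) \<Rightarrow> ratfun \<Rightarrow> ratfun \<Rightarrow> bool"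
  where "has_pullback F f g \<longleftrightarrow>
    (\<exists>P Q. Q \<noteq> 0 \<and> f = Fract P Q \<and> subst F Q \<noteq> 0 \<and> g = subst F P / subst F Q)"

lemma has_pullback_unique:
  assumes "has_pullback F f g" "has_pullback F f g'"
  shows "g = g'"
proof -
  obtain P Q where 1: "Q \<noteq> 0" "f = Fract P Q" "subst F Q \<noteq> 0" "g = subst F P / subst F Q"
    using assms(1) by (auto simp: has_pullback_def)
  obtain P' Q' where 2: "Q' \<noteq> 0" "f = Fract P' Q'" "subst F Q' \<noteq> 0" "g' = subst F P' / subst F Q'"
    using assms(2) by (auto simp: has_pullback_def)
  have "P * Q' = P' * Q" using 1 2 eq_fract(1)[of Q Q' P P'] by simp
  then have "subst F P * subst F Q' = subst F P' * subst F Q" by (simp add: subst_mult[symmetric])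
  then show ?thesis using 1 2 by (simp add: frac_eq_eq)
qed

lemma pullback_eqI:
  assumes "has_pullback F f g"
  shows "pullback F f = g"
  unfolding pullback_def has_pullback_def[symmetric]
  using assms has_pullback_unique by blast

lemma has_pullback_const: "has_pullback F (const a) (const a)"
  unfolding has_pullback_def const_def
  by (rule exI[of _ "Poly_Mapping.single 0 a"], rule exI[of _ 1])
    (simp add: subst_1 subst_const const_def)

lemma has_pullback_coords: "has_pullback F (coords n i q) (F i (q mod int n))"
  unfolding has_pullback_def coords_def
  by (rule exI[of _ "Poly_Mapping.single (Poly_Mapping.single (i, q mod int n) 1) 1"], rule exI[of _ 1])
    (simp add: subst_1 subst_coordinate[unfolded One_nat_def])

lemma has_pullback_add:
  assumes "has_pullback F f g" "has_pullback F f' g'"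
  shows "has_pullback F (f + f') (g + g')"
proof -
  obtain P Q where 1: "Q \<noteq> 0" "f = Fract P Q" "subst F Q \<noteq> 0" "g = subst F P / subst F Q"
    using assms(1) by (auto simp: has_pullback_def)
  obtain P' Q' where 2: "Q' \<noteq> 0" "f' = Fract P' Q'" "subst F Q' \<noteq> 0" "g' = subst F P' / subst F Q'"
    using assms(2) by (auto simp: has_pullback_def)
  show ?thesis unfolding has_pullback_def
    by (rule exI[of _ "P * Q' + P' * Q"], rule exI[of _ "Q * Q'"])
      (use 1 2 in \<open>simp add: subst_mult subst_add field_simps\<close>)
qed

lemma has_pullback_mult:
  assumes "has_pullback F f g" "has_pullback F f' g'"
  shows "has_pullback F (f * f') (g * g')"
proof -
  obtain P Q where 1: "Q \<noteq> 0" "f = Fract P Q" "subst F Q \<noteq> 0" "g = subst F P / subst F Q"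
    using assms(1) by (auto simp: has_pullback_def)
  obtain P' Q' where 2: "Q' \<noteq> 0" "f' = Fract P' Q'" "subst F Q' \<noteq> 0" "g' = subst F P' / subst F Q'"
    using assms(2) by (auto simp: has_pullback_def)
  show ?thesis unfolding has_pullback_def
    by (rule exI[of _ "P * P'"], rule exI[of _ "Q * Q'"])
      (use 1 2 in \<open>simp add: subst_mult\<close>)
qed

lemma has_pullback_inverse:
  assumes "has_pullback F f g" "g \<noteq> 0"
  shows "has_pullback F (inverse f) (inverse g)"
proof -
  obtain P Q where 1: "Q \<noteq> 0" "f = Fract P Q" "subst F Q \<noteq> 0" "g = subst F P / subst F Q"
    using assms(1) by (auto simp: has_pullback_def)
  have "subst F P \<noteq> 0" using 1 assms(2) by auto
  moreover have "P \<noteq> 0" using calculation subst_const[of F 0] by (auto simp: const_simps)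
  ultimately show ?thesis unfolding has_pullback_def
    by (intro exI[of _ Q] exI[of _ P]) (use 1 in simp)
qed

lemma has_pullback_divide:
  assumes "has_pullback F f g" "has_pullback F f' g'" "g' \<noteq> 0"
  shows "has_pullback F (f / f') (g / g')"
  using has_pullback_mult[OF assms(1) has_pullback_inverse[OF assms(2,3)]]
  by (simp add: divide_inverse)

lemma has_pullback_nonzero:
  assumes "has_pullback F f g" "g \<noteq> 0"
  shows "f \<noteq> 0"
  using has_pullback_unique[OF assms(1)] has_pullback_const[of F 0] assms(2)
  by (auto simp: const_simps)

lemma has_pullback_sum:
  assumes "\<And>t. t \<in> A \<Longrightarrow> has_pullback F (f t) (g t)"
  shows "has_pullback F (\<Sum>t\<in>A. f t) (\<Sum>t\<in>A. g t)"
  using assms has_pullback_const[of F 0]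
  by (induction A rule: infinite_finite_induct) (auto simp: const_simps intro: has_pullback_add)

lemma has_pullback_prod:
  assumes "\<And>t. t \<in> A \<Longrightarrow> has_pullback F (f t) (g t)"
  shows "has_pullback F (\<Prod>t\<in>A. f t) (\<Prod>t\<in>A. g t)"
  using assms has_pullback_const[of F 1]
  by (induction A rule: infinite_finite_induct) (auto simp: const_simps intro: has_pullback_mult)

lemma pullback_loop_schur:
  assumes "periodic n F"
  shows "pullback F (loop_schur m r D (coords n)) = loop_schur m r D F"
proof (rule pullback_eqI)
  have "has_pullback F (coords n i q) (F i q)" for i q
  proof -
    have "F i (q mod int n) = F i q" by (rule periodicD[OF assms]) simp
    then show ?thesis using has_pullback_coords[of F n i q] by simp
  qed
  then show "has_pullback F (loop_schur m r D (coords n)) (loop_schur m r D F)"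
    unfolding loop_schur_def by (intro has_pullback_sum has_pullback_prod)
qed

section \<open>The generic point and the theorem\<close>

text \<open>
  At the point with \<open>\<phi>\<^sub>k(x\<^sub>i) = 0\<close> and \<open>\<epsilon>\<^sub>k(x\<^sub>i) = 1\<close> for all \<open>i\<close>, the product rule gives \<open>\<epsilon>\<^sub>k = 1\<close>
  for all products, so that \<open>\<phi> + \<epsilon>\<close> and \<open>c \<phi> + \<epsilon>\<close> are both 1, whatever the value of \<open>c\<close>. The two
  coordinates can be prescribed independently because \<open>n > 1\<close>. The parameter of the first
  factors is a rational function, so the induction is over all parameters that have a value at
  that point.
\<close>

lemma act_defined_coords:
  assumes n: "n > 1" and "m \<ge> 1" and "c \<noteq> 0"
  shows "act_defined n k (coords n) m (const c)"
proof -
  \<comment> \<open>Here 1 is the value of every \<open>\<epsilon>\<^sub>k(x\<^sub>i)\<close>, and 0 that of every \<open>\<phi>\<^sub>k(x\<^sub>i)\<close>.\<close>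
  define G :: "nat \<Rightarrow> int \<Rightarrow> ratfun"
    where "G i q = (if q mod int n = (k + int i) mod int n then 1 else 0)" for i q
  have p: "has_pullback G (coords n (Suc i) (k + int i)) 0" for i
  proof -
    have "(k + int i + 1) mod int n \<noteq> (k + int i) mod int n"
    proof
      assume "(k + int i + 1) mod int n = (k + int i) mod int n"
      then have "int n dvd (k + int i + 1) - (k + int i)" by (simp only: mod_eq_dvd_iff)
      then show False using n by simp
    qed
    then show ?thesis using has_pullback_coords[of G n "Suc i" "k + int i"]
      by (simp add: G_def add.commute add.left_commute)
  qed
  have q: "has_pullback G (coords n i (k + int i)) 1" for i
    using has_pullback_coords[of G n i "k + int i"] by (simp add: G_def)
  have eps: "has_pullback G (eps (crystal_X n m) k (coords n)) 1" if "m \<ge> 1" for m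
    using that
  proof (induction m rule: nat_induct_at_least)
    case base
    then show ?case using q[of 1] by (simp only: One_nat_def crystal_X_1) simp
  next
    case (Suc m)
    show ?case unfolding crystal_X_Suc(1)[OF Suc.hyps]
      using has_pullback_divide[OF has_pullback_mult[OF Suc.IH q[of "Suc m"]]
          has_pullback_add[OF p[of m] Suc.IH]] by simp
  qed
  have "act_defined n k (coords n) m f" if "has_pullback G f g" "f \<noteq> 0" for f g
    using \<open>m \<ge> 1\<close> that
  proof (induction m arbitrary: f g rule: nat_induct_at_least)
    case base
    then show ?case using act_defined.one by simp
  next
    case (Suc m)
    let ?p = "coords n (Suc m) (k + int m)" and ?e = "eps (crystal_X n m) k (coords n)"
    have den: "has_pullback G (?p + ?e) 1"
      using has_pullback_add[OF p[of m] eps[OF Suc.hyps]] by simp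
    have num: "has_pullback G (f * ?p + ?e) 1"
      using has_pullback_add[OF has_pullback_mult[OF Suc.prems(1) p[of m]] eps[OF Suc.hyps]] by simp
    have quot: "has_pullback G ((f * ?p + ?e) / (?p + ?e)) 1"
      using has_pullback_divide[OF num den] by simp
    show ?case
    proof (rule act_defined.Suc[OF Suc.hyps Suc.prems(2) refl refl])
      show "?p + ?e \<noteq> 0" using has_pullback_nonzero[OF den] by simp
      show "f * ?p + ?e \<noteq> 0" using has_pullback_nonzero[OF num] by simp
      show "act_defined n k (coords n) m ((f * ?p + ?e) / (?p + ?e))"
        using Suc.IH[OF quot] has_pullback_nonzero[OF quot] by simp
    qed
  qed
  then show ?thesis using has_pullback_const[of G c] \<open>c \<noteq> 0\<close> by (simp add: const_eq_0_iff)
qed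

lemma diagram_down_closed:
  assumes "is_partition \<nu>" "(i, j) \<in> diagram \<nu>" "1 \<le> a" "a \<le> i" "1 \<le> b" "b \<le> j"
  shows "(a, b) \<in> diagram \<nu>"
proof -
  have "\<nu> ! (i - 1) \<le> \<nu> ! (a - 1)"
  proof (cases "a = i")
    case False
    then show ?thesis using assms sorted_wrt_nth_less[of "(\<ge>)" \<nu> "a - 1" "i - 1"]
      by (auto simp: is_partition_def diagram_def)
  qed simp
  then show ?thesis using assms by (auto simp: diagram_def)
qed

lemma skew_shape_skew:
  assumes "is_partition \<nu>" "is_partition \<mu>"
  shows "skew_shape (skew \<nu> \<mu>)"
proof -
  have "diagram \<nu> \<subseteq> (\<Union>i\<in>{1..length \<nu>}. {i} \<times> {1..\<nu> ! (i - 1)})"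
    by (auto simp: diagram_def)
  then have "finite (diagram \<nu>)" by (rule finite_subset) auto
  then have "finite (skew \<nu> \<mu>)" by (simp add: skew_def)
  moreover have "u \<in> skew \<nu> \<mu>"
    if "s \<in> skew \<nu> \<mu>" "t \<in> skew \<nu> \<mu>" "weakly_above s u" "weakly_above u t" for s t u
  proof -
    obtain i j a b i' j' where st: "s = (i, j)" "u = (a, b)" "t = (i', j')"
      by (cases s; cases t; cases u)
    have le: "i \<le> a" "a \<le> i'" "j \<le> b" "b \<le> j'" using that st by (auto simp: weakly_above_def)
    have pos: "1 \<le> i" "1 \<le> j" using that st by (auto simp: skew_def diagram_def)
    have "(a, b) \<in> diagram \<nu>"
      using diagram_down_closed[OF assms(1), of i' j' a b] le pos that st by (auto simp: skew_def)
    moreover have "(a, b) \<notin> diagram \<mu>"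
      using diagram_down_closed[OF assms(2), of a b i j] le pos that st by (auto simp: skew_def)
    ultimately show ?thesis using st by (simp add: skew_def)
  qed
  moreover have "0 < fst s \<and> 0 < snd s" if "s \<in> skew \<nu> \<mu>" for s
    using that by (auto simp: skew_def diagram_def)
  ultimately show ?thesis
    unfolding skew_shape_def by blast
qed

text \<open>
  A cell of \<open>D\<close> just above or to the left of a removed cell would contradict that this is a NW
  corner, so the removal creates no new SE corners.
\<close>

lemma SE_corners_minus_NW:
  assumes "A \<subseteq> NW_corners n r q D"
  shows "SE_corners n r q' (D - A) = SE_corners n r q' D - A"
proof -
  have "(i, j) \<notin> D" if "(i + 1, j) \<in> A \<or> (i, j + 1) \<in> A" for i j
    using that assms by (auto simp: NW_corners_def)
  then show ?thesis by (fastforce simp: SE_corners_def)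
qed

text \<open>
  Removing NW corners from \<open>D\<close> and then SE corners from the rest amounts to choosing disjoint
  sets of NW and SE corners of \<open>D\<close>, which is why the theorem sums over \<open>A \<inter> B = {}\<close>.
\<close>

lemma conv_patches_both_sides:
  assumes "n > 1" "skew_shape D"
  shows "conv (patch n r q a) (conv f (patch n r q' b)) D =
    (\<Sum>(B, A) \<in> {(B, A). B \<subseteq> SE_corners n r q' D \<and> A \<subseteq> NW_corners n r q D \<and> A \<inter> B = {}}.
      b ^ card B * a ^ card A * f (D - A - B))"
proof -
  let ?NW = "NW_corners n r q D" and ?SE = "SE_corners n r q' D"
  have fin: "finite ?NW" "finite ?SE"
    using finite_subset[OF NW_corners_subset] finite_subset[OF SE_corners_subset] skew_shapeD(1)[OF assms(2)]
    by blast+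
  have "conv (patch n r q a) (conv f (patch n r q' b)) D =
      (\<Sum>A\<in>Pow ?NW. \<Sum>B\<in>Pow (?SE - A). b ^ card B * a ^ card A * f (D - A - B))"
    unfolding conv_patch_left[OF assms]
  proof (intro sum.cong refl)
    fix A assume A: "A \<in> Pow ?NW"
    then have "A \<in> ideals D" using colored_ideal_iff[OF assms, of A r q] by simp
    then have "skew_shape (D - A)" by (rule skew_shape_ideal(2)[OF assms(2)])
    then have "conv f (patch n r q' b) (D - A) =
        (\<Sum>B\<in>Pow (?SE - A). f (D - A - B) * b ^ card B)"
      using A by (simp add: conv_patch_right[OF assms(1)] SE_corners_minus_NW)
    then show "a ^ card A * conv f (patch n r q' b) (D - A) =
        (\<Sum>B\<in>Pow (?SE - A). b ^ card B * a ^ card A * f (D - A - B))"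
      by (simp add: sum_distrib_left mult_ac)
  qed
  also have "\<dots> = (\<Sum>(A, B)\<in>(SIGMA A:Pow ?NW. Pow (?SE - A)). b ^ card B * a ^ card A * f (D - A - B))"
    using fin by (intro sum.Sigma) auto
  also have "\<dots> = (\<Sum>(B, A) \<in> {(B, A). B \<subseteq> ?SE \<and> A \<subseteq> ?NW \<and> A \<inter> B = {}}.
      b ^ card B * a ^ card A * f (D - A - B))"
    by (rule sum.reindex_bij_witness[where i = prod.swap and j = prod.swap]) auto
  finally show ?thesis .
qed

theorem theorem5p3:
  fixes n m :: nat and r k :: int and lam mu :: "nat list" and c :: complex
  assumes "n > 1" and "m \<ge> 1"
    and "is_partition lam" and "is_partition mu" and "diagram mu \<subseteq> diagram lam"
    and "c \<noteq> 0"
  shows "pullback (act (crystal_X n m) k (const c) (coords n))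
      (loop_schur m r (skew lam mu) (coords n)) =
    (\<Sum>(B, A) \<in> {(B, A). B \<subseteq> SE_corners n r (k + int m) (skew lam mu) \<and>
                     A \<subseteq> NW_corners n r k (skew lam mu) \<and> A \<inter> B = {}}.
      ((const (inverse c) - 1) * eps (crystal_X n m) k (coords n)) ^ card B *
      ((const c - 1) * phi (crystal_X n m) k (coords n)) ^ card A *
      loop_schur m r (skew lam mu - A - B) (coords n))"
proof -
  have per: "periodic n (coords n)" by (simp add: periodic_def coords_def)
  have D: "skew_shape (skew lam mu)" using assms(3,4) by (rule skew_shape_skew)
  have "pullback (act (crystal_X n m) k (const c) (coords n)) (loop_schur m r (skew lam mu) (coords n)) =
      loop_schur m r (skew lam mu) (act (crystal_X n m) k (const c) (coords n))"
    by (rule pullback_loop_schur[OF periodic_act[OF assms(2) per]])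
  also have "\<dots> = conv (patch n r k ((const c - 1) * phi (crystal_X n m) k (coords n)))
      (conv (\<lambda>E. loop_schur m r E (coords n))
        (patch n r (k + int m) ((const (inverse c) - 1) * eps (crystal_X n m) k (coords n))))
      (skew lam mu)"
    unfolding const_inverse
    by (rule loop_schur_act[OF assms(1) per act_defined_coords[OF assms(1,2,6)] D])
  finally show ?thesis unfolding conv_patches_both_sides[OF assms(1) D] .
qed

end
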